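(* Let $A$ be a locally Frobenius $k$-algebra of shape $\Lambda$ and let $S$ be a simple $A$-module which is finite dimensional over $k$. Then $S$ is not isomorphic to a submodule of $A$, or equivalently $\mathrm{Hom}_A(S,A)=0$. More generally, for every coherent $A$-module $N$, $\mathrm{Hom}_A(S,N)=0$. In particular this applies to the trivial module $S=k$.
   Context: $k$ is a field; all rings, algebras, modules and homomorphisms are unital. "$A$-module" means left $A$-module throughout, or right $A$-module throughout. Frobenius notions: a finite dimensional $k$-algebra $R$ is Frobenius if there is a linear form $\theta\colon R\to k$ (a Frobenius form) such that the bilinear form $(x,y)\mapsto\theta(xy)$ is nondegenerate; it is symmetric if $\theta$ can be chosen so that this bilinear form is symmetric. For a homomorphism of $k$-algebras $B\to C$, the extension $C:B$ is a Frobenius extension if there are a $B$-bimodule homomorphism $\Phi\colon C\to B$ and elements $x_i,y_i\in C$ ($1\le i\le n$) with $\sum_i y_i\Phi(x_ic)=c=\sum_i\Phi(cy_i)x_i$ for all $c\in C$; it is a free Frobenius extension if moreover $C$ is free as a left and as a right $B$-module. Shape: $(\Lambda,\preccurlyeq,\lambda_0)$ is an infinite partially ordered set such that any two elements have a common upper bound, $\lambda_0$ is a unique initial element, and for every $\lambda\in\Lambda$ there is $\lambda'\in\Lambda$ with $\lambda\preccurlyeq\lambda'$, $\lambda\ne\lambda'$. A (necessarily infinite dimensional) $k$-algebra $A$ is locally Frobenius of shape $\Lambda$ if: (a) there is a $\Lambda$-directed system of symmetric Frobenius $k$-algebras $A(\lambda)$ ($\lambda\in\Lambda$), augmented over $k$,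 with proper inclusion homomorphisms (of augmented algebras) $A(\lambda')\hookrightarrow A(\lambda'')$ for $\lambda'\preccurlyeq\lambda''$, $\lambda'\neq\lambda''$, with $A(\lambda_0)=k$ and $A=\bigcup_{\lambda\in\Lambda}A(\lambda)$; (b) each inclusion makes $A(\lambda''):A(\lambda')$ a free Frobenius extension. Such an $A$ is itself augmented over $k$, and the trivial module is $k$ viewed as an $A$-module via the augmentation $A\to k$. A module is pseudo-coherent if every finitely generated submodule is finitely presented, and coherent if it is finitely generated and pseudo-coherent. *)

theory Defs
  imports "HOL-Algebra.Module" "HOL-Algebra.Subrings"
begin

section \<open>Modules over a not necessarily commutative ring\<close>

text \<open>
  The locale \<^locale>\<open>module\<close> requires a commutative ring of scalars. The locale below has the same
  axioms over an arbitrary unital ring. As there, only the additive structure and the scalar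
  multiplication of the record \<open>M\<close> matter.
\<close>

locale left_module = R?: ring R + M?: abelian_group M
  for R :: "('r, 'p) ring_scheme" (structure) and M :: "('r, 'm, 'q) module_scheme" (structure) +
  assumes smult_closed:
      "\<lbrakk>a \<in> carrier R; x \<in> carrier M\<rbrakk> \<Longrightarrow> a \<odot>\<^bsub>M\<^esub> x \<in> carrier M"
    and smult_l_distr:
      "\<lbrakk>a \<in> carrier R; b \<in> carrier R; x \<in> carrier M\<rbrakk> \<Longrightarrow>
        (a \<oplus>\<^bsub>R\<^esub> b) \<odot>\<^bsub>M\<^esub> x = a \<odot>\<^bsub>M\<^esub> x \<oplus>\<^bsub>M\<^esub> b \<odot>\<^bsub>M\<^esub> x"
    and smult_r_distr:
      "\<lbrakk>a \<in> carrier R; x \<in> carrier M; y \<in> carrier M\<rbrakk> \<Longrightarrow>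
        a \<odot>\<^bsub>M\<^esub> (x \<oplus>\<^bsub>M\<^esub> y) = a \<odot>\<^bsub>M\<^esub> x \<oplus>\<^bsub>M\<^esub> a \<odot>\<^bsub>M\<^esub> y"
    and smult_assoc1:
      "\<lbrakk>a \<in> carrier R; b \<in> carrier R; x \<in> carrier M\<rbrakk> \<Longrightarrow>
        (a \<otimes>\<^bsub>R\<^esub> b) \<odot>\<^bsub>M\<^esub> x = a \<odot>\<^bsub>M\<^esub> (b \<odot>\<^bsub>M\<^esub> x)"
    and smult_one:
      "x \<in> carrier M \<Longrightarrow> \<one>\<^bsub>R\<^esub> \<odot>\<^bsub>M\<^esub> x = x"

text \<open>Right \<open>R\<close>-modules are left modules over the opposite ring.\<close>

definition opposite :: "('r, 'p) ring_scheme \<Rightarrow> ('r, 'p) ring_scheme" where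
  "opposite R = R\<lparr>monoid.mult := \<lambda>x y. y \<otimes>\<^bsub>R\<^esub> x\<rparr>"

definition regular :: "('r, 'p) ring_scheme \<Rightarrow> ('r, 'r) module" where
  "regular R = \<lparr>carrier = carrier R, monoid.mult = monoid.mult R, one = \<one>\<^bsub>R\<^esub>,
     zero = \<zero>\<^bsub>R\<^esub>, add = add R, smult = monoid.mult R\<rparr>"

definition restrict_scalars ::
  "('s \<Rightarrow> 'r) \<Rightarrow> ('r, 'm, 'q) module_scheme \<Rightarrow> ('s, 'm) module" where
  "restrict_scalars f M = \<lparr>carrier = carrier M, monoid.mult = monoid.mult M, one = \<one>\<^bsub>M\<^esub>,
     zero = \<zero>\<^bsub>M\<^esub>, add = add M, smult = \<lambda>s x. f s \<odot>\<^bsub>M\<^esub> x\<rparr>"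

definition mod_hom ::
  "('r, 'p) ring_scheme \<Rightarrow> ('r, 'm, 'q) module_scheme \<Rightarrow> ('r, 'n, 't) module_scheme
    \<Rightarrow> ('m \<Rightarrow> 'n) set" where
  "mod_hom R M N = {h \<in> carrier M \<rightarrow> carrier N.
     (\<forall>x\<in>carrier M. \<forall>y\<in>carrier M. h (x \<oplus>\<^bsub>M\<^esub> y) = h x \<oplus>\<^bsub>N\<^esub> h y) \<and>
     (\<forall>a\<in>carrier R. \<forall>x\<in>carrier M. h (a \<odot>\<^bsub>M\<^esub> x) = a \<odot>\<^bsub>N\<^esub> h x)}"

definition mod_iso ::
  "('r, 'p) ring_scheme \<Rightarrow> ('r, 'm, 'q) module_scheme \<Rightarrow> ('r, 'n, 't) module_scheme
    \<Rightarrow> bool" where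
  "mod_iso R M N \<longleftrightarrow> (\<exists>h\<in>mod_hom R M N. bij_betw h (carrier M) (carrier N))"

text \<open>
  The vanishing of \<open>Hom\<^sub>R(M, N)\<close>. Elements of \<^const>\<open>mod_hom\<close> are total functions whose values
  outside the carrier are irrelevant, so this is expressed on the carrier of \<open>M\<close> only.
\<close>

definition hom_vanishes ::
  "('r, 'p) ring_scheme \<Rightarrow> ('r, 'm, 'q) module_scheme \<Rightarrow> ('r, 'n, 't) module_scheme
    \<Rightarrow> bool" where
  "hom_vanishes R M N \<longleftrightarrow> (\<forall>h\<in>mod_hom R M N. \<forall>x\<in>carrier M. h x = \<zero>\<^bsub>N\<^esub>)"

definition generated_submodule ::
  "('r, 'p) ring_scheme \<Rightarrow> ('r, 'm, 'q) module_scheme \<Rightarrow> 'm set \<Rightarrow> 'm set" where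
  "generated_submodule R M X = \<Inter>{N. submodule N R M \<and> X \<subseteq> N}"

definition finitely_generated ::
  "('r, 'p) ring_scheme \<Rightarrow> ('r, 'm, 'q) module_scheme \<Rightarrow> bool" where
  "finitely_generated R M \<longleftrightarrow>
     (\<exists>X. finite X \<and> X \<subseteq> carrier M \<and> generated_submodule R M X = carrier M)"

definition is_basis ::
  "('r, 'p) ring_scheme \<Rightarrow> ('r, 'm, 'q) module_scheme \<Rightarrow> 'm set \<Rightarrow> bool" where
  "is_basis R M X \<longleftrightarrow>
     X \<subseteq> carrier M \<and> generated_submodule R M X = carrier M \<and>
     (\<forall>Y c. finite Y \<and> Y \<subseteq> X \<and> c \<in> Y \<rightarrow> carrier R \<and>
        finsum M (\<lambda>y. c y \<odot>\<^bsub>M\<^esub> y) Y = \<zero>\<^bsub>M\<^esub> \<longrightarrow> (\<forall>y\<in>Y. c y = \<zero>\<^bsub>R\<^esub>))"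

definition free_module ::
  "('r, 'p) ring_scheme \<Rightarrow> ('r, 'm, 'q) module_scheme \<Rightarrow> bool" where
  "free_module R M \<longleftrightarrow> left_module R M \<and> (\<exists>X. is_basis R M X)"

definition finite_dimensional ::
  "('k, 'p) ring_scheme \<Rightarrow> ('k, 'v, 'q) module_scheme \<Rightarrow> bool" where
  "finite_dimensional K V \<longleftrightarrow> module K V \<and> (\<exists>X. finite X \<and> is_basis K V X)"

text \<open>\<open>R\<^sup>n\<close>; the fields \<open>mult\<close> and \<open>one\<close> play no role.\<close>

definition free_power :: "('r, 'p) ring_scheme \<Rightarrow> nat \<Rightarrow> ('r, nat \<Rightarrow> 'r) module" where
  "free_power R n = \<lparr>carrier = {..<n} \<rightarrow>\<^sub>E carrier R,
     monoid.mult = (\<lambda>v w. \<lambda>i\<in>{..<n}. v i \<otimes>\<^bsub>R\<^esub> w i), one = (\<lambda>i\<in>{..<n}. \<one>\<^bsub>R\<^esub>),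
     zero = (\<lambda>i\<in>{..<n}. \<zero>\<^bsub>R\<^esub>), add = (\<lambda>v w. \<lambda>i\<in>{..<n}. v i \<oplus>\<^bsub>R\<^esub> w i),
     smult = (\<lambda>a v. \<lambda>i\<in>{..<n}. a \<otimes>\<^bsub>R\<^esub> v i)\<rparr>"

definition finitely_presented ::
  "('r, 'p) ring_scheme \<Rightarrow> ('r, 'm, 'q) module_scheme \<Rightarrow> bool" where
  "finitely_presented R M \<longleftrightarrow>
     (\<exists>n. \<exists>p\<in>mod_hom R (free_power R n) M.
        p ` carrier (free_power R n) = carrier M \<and>
        finitely_generated R
          ((free_power R n)\<lparr>carrier := {v \<in> carrier (free_power R n). p v = \<zero>\<^bsub>M\<^esub>}\<rparr>))"

definition pseudo_coherent ::
  "('r, 'p) ring_scheme \<Rightarrow> ('r, 'm, 'q) module_scheme \<Rightarrow> bool" where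
  "pseudo_coherent R M \<longleftrightarrow> left_module R M \<and>
     (\<forall>N. submodule N R M \<and> finitely_generated R (M\<lparr>carrier := N\<rparr>) \<longrightarrow>
        finitely_presented R (M\<lparr>carrier := N\<rparr>))"

definition coherent ::
  "('r, 'p) ring_scheme \<Rightarrow> ('r, 'm, 'q) module_scheme \<Rightarrow> bool" where
  "coherent R M \<longleftrightarrow> finitely_generated R M \<and> pseudo_coherent R M"

definition simple_module ::
  "('r, 'p) ring_scheme \<Rightarrow> ('r, 'm, 'q) module_scheme \<Rightarrow> bool" where
  "simple_module R M \<longleftrightarrow> left_module R M \<and> carrier M \<noteq> {\<zero>\<^bsub>M\<^esub>} \<and>
     (\<forall>N. submodule N R M \<longrightarrow> N = {\<zero>\<^bsub>M\<^esub>} \<or> N = carrier M)"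


section \<open>Algebras over a field\<close>

text \<open>
  The locale \<^locale>\<open>algebra\<close> is commutative; here \<open>A\<close> is any unital associative \<open>K\<close>-algebra.
\<close>

locale k_algebra = module K A + K?: field K + A?: ring A
  for K :: "('k, 'p) ring_scheme" (structure) and A :: "('k, 'a, 'q) module_scheme" (structure) +
  assumes smult_mult_left:
      "\<lbrakk>c \<in> carrier K; x \<in> carrier A; y \<in> carrier A\<rbrakk> \<Longrightarrow>
        (c \<odot>\<^bsub>A\<^esub> x) \<otimes>\<^bsub>A\<^esub> y = c \<odot>\<^bsub>A\<^esub> (x \<otimes>\<^bsub>A\<^esub> y)"
    and smult_mult_right:
      "\<lbrakk>c \<in> carrier K; x \<in> carrier A; y \<in> carrier A\<rbrakk> \<Longrightarrow>
        x \<otimes>\<^bsub>A\<^esub> (c \<odot>\<^bsub>A\<^esub> y) = c \<odot>\<^bsub>A\<^esub> (x \<otimes>\<^bsub>A\<^esub> y)"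

definition k_subalgebra ::
  "('k, 'p) ring_scheme \<Rightarrow> ('k, 'a, 'q) module_scheme \<Rightarrow> 'a set \<Rightarrow> bool" where
  "k_subalgebra K A B \<longleftrightarrow> subring B A \<and> submodule B K A"

definition algebra_hom ::
  "('k, 'p) ring_scheme \<Rightarrow> ('k, 'a, 'q) module_scheme \<Rightarrow> ('k, 'b, 't) module_scheme
    \<Rightarrow> ('a \<Rightarrow> 'b) set" where
  "algebra_hom K A B = ring_hom A B \<inter> mod_hom K A B"

text \<open>The vector space underlying a module \<open>M\<close> over the algebra \<open>A\<close>.\<close>

definition underlying_space ::
  "('k, 'a, 'q) module_scheme \<Rightarrow> ('a, 'm, 't) module_scheme \<Rightarrow> ('k, 'm) module" where
  "underlying_space A M = restrict_scalars (\<lambda>c. c \<odot>\<^bsub>A\<^esub> \<one>\<^bsub>A\<^esub>) M"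


section \<open>Frobenius algebras and Frobenius extensions\<close>

definition frobenius_form ::
  "('k, 'p) ring_scheme \<Rightarrow> ('k, 'a, 'q) module_scheme \<Rightarrow> ('a \<Rightarrow> 'k) \<Rightarrow> bool" where
  "frobenius_form K R \<theta> \<longleftrightarrow> \<theta> \<in> mod_hom K R (regular K) \<and>
     (\<forall>x\<in>carrier R. (\<forall>y\<in>carrier R. \<theta> (x \<otimes>\<^bsub>R\<^esub> y) = \<zero>\<^bsub>K\<^esub>) \<longrightarrow> x = \<zero>\<^bsub>R\<^esub>) \<and>
     (\<forall>y\<in>carrier R. (\<forall>x\<in>carrier R. \<theta> (x \<otimes>\<^bsub>R\<^esub> y) = \<zero>\<^bsub>K\<^esub>) \<longrightarrow> y = \<zero>\<^bsub>R\<^esub>)"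

definition symmetric_frobenius_algebra ::
  "('k, 'p) ring_scheme \<Rightarrow> ('k, 'a, 'q) module_scheme \<Rightarrow> bool" where
  "symmetric_frobenius_algebra K R \<longleftrightarrow> k_algebra K R \<and> finite_dimensional K R \<and>
     (\<exists>\<theta>. frobenius_form K R \<theta> \<and>
        (\<forall>x\<in>carrier R. \<forall>y\<in>carrier R. \<theta> (x \<otimes>\<^bsub>R\<^esub> y) = \<theta> (y \<otimes>\<^bsub>R\<^esub> x)))"

text \<open>
  For \<open>f : B \<rightarrow> C\<close>, the ring \<open>C\<close> is a left \<open>B\<close>-module via \<^term>\<open>restrict_scalars f (regular C)\<close>;
  its right \<open>B\<close>-module structure is obtained by passing to opposites.
\<close>

definition bimodule_hom_to_base ::
  "('b \<Rightarrow> 'c) \<Rightarrow> ('b, 'p) ring_scheme \<Rightarrow> ('c, 'q) ring_scheme \<Rightarrow> ('c \<Rightarrow> 'b) set" where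
  "bimodule_hom_to_base f B C =
     mod_hom B (restrict_scalars f (regular C)) (regular B) \<inter>
     mod_hom (opposite B) (restrict_scalars f (regular (opposite C))) (regular (opposite B))"

definition frobenius_extension ::
  "('k, 'p) ring_scheme \<Rightarrow> ('b \<Rightarrow> 'c) \<Rightarrow> ('k, 'b, 'q) module_scheme
    \<Rightarrow> ('k, 'c, 't) module_scheme \<Rightarrow> bool" where
  "frobenius_extension K f B C \<longleftrightarrow> f \<in> algebra_hom K B C \<and>
     (\<exists>\<Phi>\<in>bimodule_hom_to_base f B C. \<exists>n::nat. \<exists>x\<in>{1..n} \<rightarrow> carrier C. \<exists>y\<in>{1..n} \<rightarrow> carrier C.
        \<forall>c\<in>carrier C.
          (\<Oplus>\<^bsub>C\<^esub>i\<in>{1..n}. y i \<otimes>\<^bsub>C\<^esub> f (\<Phi> (x i \<otimes>\<^bsub>C\<^esub> c))) = c \<and>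
          (\<Oplus>\<^bsub>C\<^esub>i\<in>{1..n}. f (\<Phi> (c \<otimes>\<^bsub>C\<^esub> y i)) \<otimes>\<^bsub>C\<^esub> x i) = c)"

definition free_frobenius_extension ::
  "('k, 'p) ring_scheme \<Rightarrow> ('b \<Rightarrow> 'c) \<Rightarrow> ('k, 'b, 'q) module_scheme
    \<Rightarrow> ('k, 'c, 't) module_scheme \<Rightarrow> bool" where
  "free_frobenius_extension K f B C \<longleftrightarrow> frobenius_extension K f B C \<and>
     free_module B (restrict_scalars f (regular C)) \<and>
     free_module (opposite B) (restrict_scalars f (regular (opposite C)))"


section \<open>Locally Frobenius algebras\<close>

text \<open>
  The order \<open>\<preceq>\<close> on \<open>\<Lambda>\<close> is given as a relation \<open>r\<close>. Uniqueness of the initial element follows from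
  antisymmetry.
\<close>

locale frobenius_shape =
  fixes \<Lambda> :: "'l set" and r :: "('l \<times> 'l) set" and l0 :: 'l
  assumes partial_order: "partial_order_on \<Lambda> r"
    and infinite: "infinite \<Lambda>"
    and directed: "\<lbrakk>l \<in> \<Lambda>; m \<in> \<Lambda>\<rbrakk> \<Longrightarrow> \<exists>u\<in>\<Lambda>. (l, u) \<in> r \<and> (m, u) \<in> r"
    and initial_in: "l0 \<in> \<Lambda>"
    and initial: "l \<in> \<Lambda> \<Longrightarrow> (l0, l) \<in> r"
    and no_maximal: "l \<in> \<Lambda> \<Longrightarrow> \<exists>m\<in>\<Lambda>. (l, m) \<in> r \<and> l \<noteq> m"

text \<open>
  The algebras \<open>A(l)\<close> of the directed system are the subalgebras \<^term>\<open>A\<lparr>carrier := F l\<rparr>\<close> of their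
  union \<open>A\<close>, with augmentations \<open>\<epsilon> l\<close>; the transition maps are inclusions.
\<close>

locale locally_frobenius = frobenius_shape \<Lambda> r l0 + k_algebra K A
  for K :: "'k ring" and A :: "('k, 'a) module"
    and \<Lambda> :: "'l set" and r :: "('l \<times> 'l) set" and l0 :: 'l
    and F :: "'l \<Rightarrow> 'a set" and \<epsilon> :: "'l \<Rightarrow> 'a \<Rightarrow> 'k" +
  assumes subalgebra: "l \<in> \<Lambda> \<Longrightarrow> k_subalgebra K A (F l)"
    and symmetric_frobenius: "l \<in> \<Lambda> \<Longrightarrow> symmetric_frobenius_algebra K (A\<lparr>carrier := F l\<rparr>)"
    and augmentation: "l \<in> \<Lambda> \<Longrightarrow> \<epsilon> l \<in> algebra_hom K (A\<lparr>carrier := F l\<rparr>) (regular K)"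
    and proper_inclusion: "\<lbrakk>(l, m) \<in> r; l \<noteq> m\<rbrakk> \<Longrightarrow> F l \<subset> F m"
    and augmentation_compatible: "\<lbrakk>(l, m) \<in> r; x \<in> F l\<rbrakk> \<Longrightarrow> \<epsilon> m x = \<epsilon> l x"
    and initial_algebra: "F l0 = (\<lambda>c. c \<odot>\<^bsub>A\<^esub> \<one>\<^bsub>A\<^esub>) ` carrier K"
    and union: "carrier A = (\<Union>l\<in>\<Lambda>. F l)"
    and free_frobenius: "\<lbrakk>(l, m) \<in> r; l \<noteq> m\<rbrakk> \<Longrightarrow>
      free_frobenius_extension K id (A\<lparr>carrier := F l\<rparr>) (A\<lparr>carrier := F m\<rparr>)"

definition union_augmentation ::
  "'l set \<Rightarrow> ('l \<Rightarrow> 'a set) \<Rightarrow> ('l \<Rightarrow> 'a \<Rightarrow> 'k) \<Rightarrow> 'a \<Rightarrow> 'k" where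
  "union_augmentation \<Lambda> F \<epsilon> x = (THE c. \<exists>l\<in>\<Lambda>. x \<in> F l \<and> c = \<epsilon> l x)"

text \<open>
  Since \<open>K\<close> is commutative, this record is both the trivial left and the trivial right module.
\<close>

definition trivial_module ::
  "'k ring \<Rightarrow> 'l set \<Rightarrow> ('l \<Rightarrow> 'a set) \<Rightarrow> ('l \<Rightarrow> 'a \<Rightarrow> 'k) \<Rightarrow> ('a, 'k) module" where
  "trivial_module K \<Lambda> F \<epsilon> = restrict_scalars (union_augmentation \<Lambda> F \<epsilon>) (regular K)"

end

theory Submission
  imports Defs
begin

text \<open>
  Let \<open>F l \<subset> F m\<close> be two members of the directed system. A basis of \<open>F m\<close> as a right \<open>F l\<close>-module has
  at least two elements, so there are \<open>b, c \<in> F m\<close> and right \<open>F l\<close>-linear maps \<open>\<phi>, \<psi> : F m \<rightarrow> F l\<close> with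
  \<open>\<phi> b = \<psi> c = 1\<close> and \<open>\<phi> c = \<psi> b = 0\<close>. If \<open>S\<close> is a finite dimensional left ideal, choose \<open>l\<close> with
  \<open>S \<subseteq> F l\<close>; applying \<open>\<phi>\<close> and \<open>\<psi>\<close> to \<open>b s = c t\<close> gives \<open>s = t = 0\<close>. Hence multiplication by \<open>b\<close> is an
  injective, so surjective, endomorphism of \<open>S\<close> whose image meets \<open>c S\<close> only in \<open>0\<close>, and \<open>S = 0\<close>.
  The same argument shows that a finite dimensional finitely presented module \<open>S = A\<^sup>n / L\<close> vanishes:
  choose \<open>l\<close> such that the entries of generators of \<open>L\<close> and of lifts of a basis of \<open>S\<close> lie in \<open>F l\<close>,
  and use that \<open>L \<inter> (F m)\<^sup>n\<close> is the \<open>F m\<close>-span of these generators, so that \<open>\<phi>\<close> and \<open>\<psi>\<close> map it into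
  \<open>L \<inter> (F l)\<^sup>n\<close>.
\<close>

section \<open>Modules over a noncommutative ring\<close>

lemma (in abelian_group) add_minus_add_right:
  assumes "x \<in> carrier G" "y \<in> carrier G" "z \<in> carrier G"
  shows "(x \<oplus> z) \<ominus> (y \<oplus> z) = x \<ominus> y"
proof -
  have "(x \<oplus> z) \<ominus> (y \<oplus> z) = x \<oplus> ((z \<oplus> \<ominus> z) \<oplus> \<ominus> y)"
    using assms by (simp only: minus_eq minus_add a_ac a_inv_closed add.m_closed)
  then show ?thesis using assms by (simp add: r_neg minus_eq)
qed

section \<open>Submodules, spans and chains in finite dimensional spaces\<close>

context left_module
begin

lemma smult_zero_left: "x \<in> carrier M \<Longrightarrow> \<zero>\<^bsub>R\<^esub> \<odot>\<^bsub>M\<^esub> x = \<zero>\<^bsub>M\<^esub>"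
  by (metis M.add.r_cancel_one' R.l_zero R.zero_closed smult_closed smult_l_distr)

lemma smult_zero_right: "a \<in> carrier R \<Longrightarrow> a \<odot>\<^bsub>M\<^esub> \<zero>\<^bsub>M\<^esub> = \<zero>\<^bsub>M\<^esub>"
  by (metis M.add.r_cancel_one' M.l_zero M.zero_closed smult_closed smult_r_distr)

lemma smult_minus_left:
  assumes "a \<in> carrier R" "x \<in> carrier M"
  shows "(\<ominus>\<^bsub>R\<^esub> a) \<odot>\<^bsub>M\<^esub> x = \<ominus>\<^bsub>M\<^esub> (a \<odot>\<^bsub>M\<^esub> x)"
proof -
  have "(\<ominus>\<^bsub>R\<^esub> a) \<odot>\<^bsub>M\<^esub> x \<oplus>\<^bsub>M\<^esub> a \<odot>\<^bsub>M\<^esub> x = \<zero>\<^bsub>M\<^esub>"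
    using assms smult_l_distr[of "\<ominus>\<^bsub>R\<^esub> a" a x] by (simp add: R.l_neg smult_zero_left)
  then show ?thesis
    using assms by (metis M.minus_equality R.a_inv_closed smult_closed)
qed

lemma minus_one_smult: "x \<in> carrier M \<Longrightarrow> (\<ominus>\<^bsub>R\<^esub> \<one>\<^bsub>R\<^esub>) \<odot>\<^bsub>M\<^esub> x = \<ominus>\<^bsub>M\<^esub> x"
  by (simp add: smult_minus_left smult_one)

text \<open>Closure under negation comes from closure under scalars, since \<open>- x\<close> is
  \<open>(- 1) x\<close>.\<close>

lemma submoduleI:
  assumes "H \<subseteq> carrier M" "\<zero>\<^bsub>M\<^esub> \<in> H"
    and "\<And>x y. \<lbrakk>x \<in> H; y \<in> H\<rbrakk> \<Longrightarrow> x \<oplus>\<^bsub>M\<^esub> y \<in> H"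
    and "\<And>a x. \<lbrakk>a \<in> carrier R; x \<in> H\<rbrakk> \<Longrightarrow> a \<odot>\<^bsub>M\<^esub> x \<in> H"
  shows "submodule H R M"
proof -
  have "\<ominus>\<^bsub>M\<^esub> x \<in> H" if "x \<in> H" for x
    using that assms(1) assms(4)[of "\<ominus>\<^bsub>R\<^esub> \<one>\<^bsub>R\<^esub>" x] minus_one_smult[of x] by auto
  then show ?thesis
    using assms by (intro submodule.intro subgroup.intro) (auto simp: submodule_axioms_def a_inv_def)
qed

lemma submoduleD:
  assumes "submodule H R M"
  shows "H \<subseteq> carrier M" "\<zero>\<^bsub>M\<^esub> \<in> H"
    and "\<And>x y. \<lbrakk>x \<in> H; y \<in> H\<rbrakk> \<Longrightarrow> x \<oplus>\<^bsub>M\<^esub> y \<in> H"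
    and "\<And>a x. \<lbrakk>a \<in> carrier R; x \<in> H\<rbrakk> \<Longrightarrow> a \<odot>\<^bsub>M\<^esub> x \<in> H"
    and "\<And>x y. \<lbrakk>x \<in> H; y \<in> H\<rbrakk> \<Longrightarrow> x \<ominus>\<^bsub>M\<^esub> y \<in> H"
proof -
  note sg = submodule.axioms(1)[OF assms]
  show sub: "H \<subseteq> carrier M" "\<zero>\<^bsub>M\<^esub> \<in> H"
    and add: "\<And>x y. \<lbrakk>x \<in> H; y \<in> H\<rbrakk> \<Longrightarrow> x \<oplus>\<^bsub>M\<^esub> y \<in> H"
    using subgroup.subset[OF sg] subgroup.one_closed[OF sg] subgroup.m_closed[OF sg] by auto
  show sm: "\<And>a x. \<lbrakk>a \<in> carrier R; x \<in> H\<rbrakk> \<Longrightarrow> a \<odot>\<^bsub>M\<^esub> x \<in> H"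
    using submodule.smult_closed[OF assms] .
  show "\<And>x y. \<lbrakk>x \<in> H; y \<in> H\<rbrakk> \<Longrightarrow> x \<ominus>\<^bsub>M\<^esub> y \<in> H"
    using sub add sm[of "\<ominus>\<^bsub>R\<^esub> \<one>\<^bsub>R\<^esub>"] minus_one_smult by (metis M.minus_eq R.a_inv_closed R.one_closed subsetD)
qed

lemma carrier_submodule: "submodule (carrier M) R M"
  by (rule submoduleI) (auto intro: smult_closed)

lemma zero_submodule: "submodule {\<zero>\<^bsub>M\<^esub>} R M"
  by (rule submoduleI) (auto simp: smult_zero_right)

lemma generated_submodule_least:
  "submodule N R M \<Longrightarrow> X \<subseteq> N \<Longrightarrow> generated_submodule R M X \<subseteq> N"
  by (auto simp: generated_submodule_def)

lemma generated_submodule_incl: "X \<subseteq> generated_submodule R M X"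
  by (auto simp: generated_submodule_def)

lemma generated_submodule_submodule:
  assumes "X \<subseteq> carrier M"
  shows "submodule (generated_submodule R M X) R M"
  using carrier_submodule assms
  by (intro submoduleI) (auto simp: generated_submodule_def intro: submoduleD(2-4))

lemma generated_submodule_carrier: "X \<subseteq> carrier M \<Longrightarrow> generated_submodule R M X \<subseteq> carrier M"
  by (simp add: generated_submodule_least carrier_submodule)

lemma generated_submodule_empty: "generated_submodule R M {} = {\<zero>\<^bsub>M\<^esub>}"
  using generated_submodule_least[OF zero_submodule, of "{}"]
    submoduleD(2)[OF generated_submodule_submodule[of "{}"]] by auto

text \<open>The elements \<open>w + c x\<close> already form a submodule containing
  \<open>insert x X\<close>. Splitting off one generator drives both the induction on chains below
  and the construction of basis coordinates.\<close>

lemma generated_submodule_insert: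
  assumes X: "X \<subseteq> carrier M" and x: "x \<in> carrier M"
    and u: "u \<in> generated_submodule R M (insert x X)"
  obtains w c where "w \<in> generated_submodule R M X" "c \<in> carrier R" "u = w \<oplus>\<^bsub>M\<^esub> c \<odot>\<^bsub>M\<^esub> x"
proof -
  let ?W = "generated_submodule R M X"
  let ?N = "{w \<oplus>\<^bsub>M\<^esub> c \<odot>\<^bsub>M\<^esub> x |w c. w \<in> ?W \<and> c \<in> carrier R}"
  note W = submoduleD[OF generated_submodule_submodule[OF X]]
  have "submodule ?N R M"
  proof (rule submoduleI)
    show "?N \<subseteq> carrier M" using W(1) x by (auto intro: smult_closed)
    show "\<zero>\<^bsub>M\<^esub> \<in> ?N" using W(2) x smult_zero_left[OF x] by (intro CollectI exI[of _ "\<zero>\<^bsub>M\<^esub>"] exI[of _ "\<zero>\<^bsub>R\<^esub>"]) auto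
  next
    fix y z assume "y \<in> ?N" "z \<in> ?N"
    then obtain w c v d where *: "y = w \<oplus>\<^bsub>M\<^esub> c \<odot>\<^bsub>M\<^esub> x" "w \<in> ?W" "c \<in> carrier R"
      "z = v \<oplus>\<^bsub>M\<^esub> d \<odot>\<^bsub>M\<^esub> x" "v \<in> ?W" "d \<in> carrier R" by auto
    have "w \<in> carrier M" "v \<in> carrier M" using * W(1) by auto
    then have "y \<oplus>\<^bsub>M\<^esub> z = (w \<oplus>\<^bsub>M\<^esub> v) \<oplus>\<^bsub>M\<^esub> (c \<oplus>\<^bsub>R\<^esub> d) \<odot>\<^bsub>M\<^esub> x"
      using * x by (simp add: smult_l_distr smult_closed M.a_ac)
    then show "y \<oplus>\<^bsub>M\<^esub> z \<in> ?N" using * W(3) by blast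
  next
    fix a y assume a: "a \<in> carrier R" and "y \<in> ?N"
    then obtain w c where *: "y = w \<oplus>\<^bsub>M\<^esub> c \<odot>\<^bsub>M\<^esub> x" "w \<in> ?W" "c \<in> carrier R" by auto
    have "w \<in> carrier M" using * W(1) by auto
    then have "a \<odot>\<^bsub>M\<^esub> y = a \<odot>\<^bsub>M\<^esub> w \<oplus>\<^bsub>M\<^esub> (a \<otimes>\<^bsub>R\<^esub> c) \<odot>\<^bsub>M\<^esub> x"
      using * x a by (simp add: smult_r_distr smult_closed smult_assoc1)
    then show "a \<odot>\<^bsub>M\<^esub> y \<in> ?N" using * a W(4) by blast
  qed
  moreover have "insert x X \<subseteq> ?N"
  proof
    fix y assume "y \<in> insert x X"
    then show "y \<in> ?N"
    proof
      assume "y = x"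
      then show ?thesis using x W(2) by (intro CollectI exI[of _ "\<zero>\<^bsub>M\<^esub>"] exI[of _ "\<one>\<^bsub>R\<^esub>"]) (auto simp: smult_one)
    next
      assume "y \<in> X"
      then show ?thesis using x X generated_submodule_incl[of X] smult_zero_left[OF x]
        by (intro CollectI exI[of _ y] exI[of _ "\<zero>\<^bsub>R\<^esub>"]) auto
    qed
  qed
  ultimately have "u \<in> ?N" using u generated_submodule_least[of ?N] by blast
  then show thesis using that by blast
qed

text \<open>
  A chain in the span of \<open>insert x X\<close> stabilises because its intersections with the span of \<open>X\<close> do,
  and because containment in the span of \<open>X\<close> persists once it holds.
\<close>

lemma descending_chain_stabilises:
  assumes "field R" "finite X" "X \<subseteq> carrier M" "\<And>i. submodule (U i) R M"
    "\<And>i. U i \<subseteq> generated_submodule R M X" "\<And>i. U (Suc i) \<subseteq> U i"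
  shows "\<exists>n. \<forall>m\<ge>n. U m = U n"
  using assms(2-)
proof (induction X arbitrary: U rule: finite_induct)
  case empty
  then have "U i = {\<zero>\<^bsub>M\<^esub>}" for i
    using generated_submodule_empty submoduleD(2)[OF empty(2)] by blast
  then show ?case by auto
next
  case (insert x X)
  interpret R: field R by fact
  let ?W = "generated_submodule R M X"
  have X: "X \<subseteq> carrier M" and x: "x \<in> carrier M" using insert.prems by auto
  note W = submoduleD[OF generated_submodule_submodule[OF X]]
  note U = submoduleD[OF insert.prems(2)]
  have desc: "U j \<subseteq> U i" if "i \<le> j" for i j
    using that insert.prems(4) by (rule lift_Suc_antimono_le[rotated])
  have "\<exists>n. \<forall>m\<ge>n. U m \<inter> ?W = U n \<inter> ?W"
  proof (rule insert.IH[of "\<lambda>i. U i \<inter> ?W"])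
    show "submodule (U i \<inter> ?W) R M" for i
      using U W by (intro submoduleI) auto
  qed (use X insert.prems(4) in auto)
  then obtain n where n: "\<And>m. m \<ge> n \<Longrightarrow> U m \<inter> ?W = U n \<inter> ?W" by blast
  \<comment> \<open>Such a \<open>k\<close> exists: take an index past \<open>n\<close> whose member
    lies in \<open>?W\<close> if there is one, and \<open>n\<close> otherwise.\<close>
  obtain k where k: "k \<ge> n" "\<forall>i\<ge>n. U i \<subseteq> ?W \<longrightarrow> U k \<subseteq> ?W" by blast
  have "U m = U k" if m: "m \<ge> k" for m
  proof (cases "U k \<subseteq> ?W")
    case True
    then show ?thesis using desc[OF m] n[of m] n[of k] m k(1) by auto
  next
    case False
    then have "\<not> U m \<subseteq> ?W" using k m by auto
    then obtain z where z: "z \<in> U m" "z \<notin> ?W" by auto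
    from z obtain w c where wc: "w \<in> ?W" "c \<in> carrier R" "z = w \<oplus>\<^bsub>M\<^esub> c \<odot>\<^bsub>M\<^esub> x"
      using generated_submodule_insert[OF X x] insert.prems(3) by blast
    have wM: "w \<in> carrier M" using wc W(1) by auto
    \<comment> \<open>If \<open>c\<close> were zero, then \<open>z = w\<close> would lie in
      \<open>?W\<close>; over a field \<open>c\<close> is thus invertible.\<close>
    have "c \<noteq> \<zero>\<^bsub>R\<^esub>" using z wc wM smult_zero_left[OF x] by auto
    then have c: "c \<in> Units R" using wc R.field_Units by auto
    have "u \<in> U m" if u: "u \<in> U k" for u
    proof -
      obtain v d where vd: "v \<in> ?W" "d \<in> carrier R" "u = v \<oplus>\<^bsub>M\<^esub> d \<odot>\<^bsub>M\<^esub> x"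
        using generated_submodule_insert[OF X x] insert.prems(3) u by blast
      have vM: "v \<in> carrier M" using vd W(1) by auto
      \<comment> \<open>With this factor \<open>u\<close> and \<open>?e z\<close> have the same
        coefficient at \<open>x\<close>. Their difference falls into \<open>?W\<close>, where the
        chain is already constant from \<open>n\<close> on.\<close>
      let ?e = "d \<otimes>\<^bsub>R\<^esub> inv\<^bsub>R\<^esub> c"
      have e: "?e \<in> carrier R" "?e \<otimes>\<^bsub>R\<^esub> c = d" using c vd wc by (auto simp: R.m_assoc)
      have ez: "?e \<odot>\<^bsub>M\<^esub> z = ?e \<odot>\<^bsub>M\<^esub> w \<oplus>\<^bsub>M\<^esub> d \<odot>\<^bsub>M\<^esub> x"
        using e wc wM x by (simp add: smult_r_distr smult_closed flip: smult_assoc1)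
      have cl: "?e \<odot>\<^bsub>M\<^esub> w \<in> carrier M" "d \<odot>\<^bsub>M\<^esub> x \<in> carrier M" "?e \<odot>\<^bsub>M\<^esub> z \<in> carrier M"
        using e wM vd x z U(1) by (auto intro!: smult_closed)
      have "u \<ominus>\<^bsub>M\<^esub> ?e \<odot>\<^bsub>M\<^esub> z = v \<ominus>\<^bsub>M\<^esub> ?e \<odot>\<^bsub>M\<^esub> w"
        unfolding ez vd(3)
        by (rule M.add_minus_add_right[rotated 2]) (use cl vM in auto)
      also have "\<dots> \<in> ?W" using W vd wc e by auto
      finally have "u \<ominus>\<^bsub>M\<^esub> ?e \<odot>\<^bsub>M\<^esub> z \<in> ?W" .
      moreover have "u \<ominus>\<^bsub>M\<^esub> ?e \<odot>\<^bsub>M\<^esub> z \<in> U k" using U u z e desc[OF m] by auto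
      ultimately have "u \<ominus>\<^bsub>M\<^esub> ?e \<odot>\<^bsub>M\<^esub> z \<in> U m" using n[of m] n[of k] m k(1) by auto
      then have "(u \<ominus>\<^bsub>M\<^esub> ?e \<odot>\<^bsub>M\<^esub> z) \<oplus>\<^bsub>M\<^esub> ?e \<odot>\<^bsub>M\<^esub> z \<in> U m" using U z e by auto
      moreover have "u \<in> carrier M" using u U(1) by auto
      ultimately show ?thesis using cl by (simp add: M.minus_eq M.a_assoc M.l_neg)
    qed
    then show ?thesis using desc[OF m] by auto
  qed
  then show ?case by auto
qed

section \<open>Linear maps and injective endomorphisms\<close>

lemma mod_hom_zero:
  assumes "left_module R N" "h \<in> mod_hom R M N"
  shows "h \<zero>\<^bsub>M\<^esub> = \<zero>\<^bsub>N\<^esub>"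
proof -
  interpret N: left_module R N by fact
  have "h (\<zero>\<^bsub>R\<^esub> \<odot>\<^bsub>M\<^esub> \<zero>\<^bsub>M\<^esub>) = \<zero>\<^bsub>R\<^esub> \<odot>\<^bsub>N\<^esub> h \<zero>\<^bsub>M\<^esub>" "h \<zero>\<^bsub>M\<^esub> \<in> carrier N"
    using assms(2) by (auto simp: mod_hom_def)
  then show ?thesis by (simp add: smult_zero_left N.smult_zero_left)
qed

lemma mod_hom_submodule_image:
  assumes "left_module R N" "h \<in> mod_hom R M N" "submodule H R M"
  shows "submodule (h ` H) R N"
proof -
  interpret N: left_module R N by fact
  note H = submoduleD[OF assms(3)]
  show ?thesis
  proof (rule N.submoduleI)
    show "h ` H \<subseteq> carrier N" using assms(2) H(1) by (auto simp: mod_hom_def)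
    show "\<zero>\<^bsub>N\<^esub> \<in> h ` H" using mod_hom_zero[OF assms(1,2)] H(2) by (metis imageI)
  next
    fix y z assume "y \<in> h ` H" "z \<in> h ` H"
    then obtain u v where "y = h u" "u \<in> H" "z = h v" "v \<in> H" by auto
    moreover have "h (u \<oplus>\<^bsub>M\<^esub> v) = h u \<oplus>\<^bsub>N\<^esub> h v"
      using assms(2) H(1) calculation by (auto simp: mod_hom_def subset_iff)
    ultimately show "y \<oplus>\<^bsub>N\<^esub> z \<in> h ` H" using H(3) by (metis imageI)
  next
    fix a y assume "a \<in> carrier R" "y \<in> h ` H"
    moreover then obtain u where "y = h u" "u \<in> H" by auto
    moreover have "h (a \<odot>\<^bsub>M\<^esub> u) = a \<odot>\<^bsub>N\<^esub> h u"
      using assms(2) H(1) calculation by (auto simp: mod_hom_def subset_iff)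
    ultimately show "a \<odot>\<^bsub>N\<^esub> y \<in> h ` H" using H(4) by (metis imageI)
  qed
qed

lemma mod_hom_kernel_submodule:
  assumes "left_module R N" "h \<in> mod_hom R M N"
  shows "submodule {x \<in> carrier M. h x = \<zero>\<^bsub>N\<^esub>} R M"
proof -
  interpret N: left_module R N by fact
  show ?thesis
    using assms mod_hom_zero[OF assms]
    by (intro submoduleI) (auto simp: mod_hom_def smult_closed N.smult_zero_right)
qed

lemma mod_hom_inj_onI:
  assumes "left_module R N" "h \<in> mod_hom R M N"
    and "\<And>x. x \<in> carrier M \<Longrightarrow> h x = \<zero>\<^bsub>N\<^esub> \<Longrightarrow> x = \<zero>\<^bsub>M\<^esub>"
  shows "inj_on h (carrier M)"
proof (rule inj_onI)
  interpret N: left_module R N by fact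
  fix x y assume xy: "x \<in> carrier M" "y \<in> carrier M" "h x = h y"
  let ?n = "(\<ominus>\<^bsub>R\<^esub> \<one>\<^bsub>R\<^esub>) \<odot>\<^bsub>M\<^esub> y"
  have "?n \<in> carrier M" using xy by (intro smult_closed) auto
  then have "h (x \<oplus>\<^bsub>M\<^esub> ?n) = h x \<oplus>\<^bsub>N\<^esub> (\<ominus>\<^bsub>R\<^esub> \<one>\<^bsub>R\<^esub>) \<odot>\<^bsub>N\<^esub> h y"
    using assms(2) xy by (auto simp: mod_hom_def)
  moreover have "h y \<in> carrier N" using assms(2) xy by (auto simp: mod_hom_def)
  ultimately have "h (x \<oplus>\<^bsub>M\<^esub> ?n) = \<zero>\<^bsub>N\<^esub>" using xy(3) by (simp add: N.minus_one_smult N.r_neg)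
  then have "x \<oplus>\<^bsub>M\<^esub> \<ominus>\<^bsub>M\<^esub> y = \<zero>\<^bsub>M\<^esub>"
    using assms(3) xy by (simp add: minus_one_smult)
  then show "x = y" using xy by (metis M.minus_equality M.minus_minus M.a_inv_closed)
qed

lemma inj_endomorphism_surj:
  assumes "field R" "finite X" "X \<subseteq> carrier M" "generated_submodule R M X = carrier M"
    and f: "f \<in> mod_hom R M M" and inj: "inj_on f (carrier M)"
  shows "f ` carrier M = carrier M"
proof -
  let ?U = "\<lambda>i. (f ^^ i) ` carrier M"
  have fM: "f ` carrier M \<subseteq> carrier M" using f by (auto simp: mod_hom_def)
  have U: "submodule (?U i) R M" for i
  proof (induction i)
    case 0 then show ?case by (simp add: carrier_submodule)
  next
    case (Suc i)
    then show ?case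
      using mod_hom_submodule_image[OF left_module_axioms f Suc] by (simp add: image_comp)
  qed
  have "?U (Suc i) \<subseteq> ?U i" for i
    using fM by (auto simp: funpow_Suc_right simp del: funpow.simps)
  moreover have "?U i \<subseteq> generated_submodule R M X" for i
    using submoduleD(1)[OF U] assms(4) by auto
  ultimately obtain n where "?U (Suc n) = ?U n"
    using descending_chain_stabilises[of X ?U] assms(1-3) U by (metis le_SucI order_refl)
  then have "(f ^^ n) ` f ` carrier M = (f ^^ n) ` carrier M"
    by (simp only: funpow_Suc_right image_comp)
  moreover have "inj_on (f ^^ n) (carrier M)"
  proof (induction n)
    case (Suc n)
    have "f ` carrier M \<subseteq> carrier M" by (rule fM)
    then have "inj_on (f ^^ n \<circ> f) (carrier M)"
      using Suc inj by (intro comp_inj_on) (auto intro: inj_on_subset)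
    then show ?case by (simp only: funpow_Suc_right)
  qed simp
  ultimately show ?thesis using inj_on_image_eq_iff fM by (metis order_refl)
qed

section \<open>Submodules as modules, linear combinations and coordinates\<close>

lemma submodule_left_module:
  assumes "submodule H R M"
  shows "left_module R (M\<lparr>carrier := H\<rparr>)"
proof -
  note H = submoduleD[OF assms]
  have M: "x \<in> carrier M" if "x \<in> H" for x using H(1) that by auto
  have "abelian_group (M\<lparr>carrier := H\<rparr>)"
  proof (rule abelian_groupI)
    fix x assume x: "x \<in> carrier (M\<lparr>carrier := H\<rparr>)"
    then have "\<ominus>\<^bsub>M\<^esub> x \<in> H" using H(4)[of "\<ominus>\<^bsub>R\<^esub> \<one>\<^bsub>R\<^esub>" x] M minus_one_smult by simp
    then show "\<exists>y\<in>carrier (M\<lparr>carrier := H\<rparr>). y \<oplus>\<^bsub>M\<lparr>carrier := H\<rparr>\<^esub> x = \<zero>\<^bsub>M\<lparr>carrier := H\<rparr>\<^esub>"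
      using x M by (auto intro: M.l_neg)
  qed (use H M in \<open>auto simp: M.a_ac\<close>)
  then show ?thesis
    using R.ring_axioms H M
    by (intro left_module.intro left_module_axioms.intro)
      (auto simp: smult_l_distr smult_r_distr smult_assoc1 smult_one)
qed

text \<open>The submodules of \<open>H\<close> are the submodules of \<open>M\<close> inside
  \<open>H\<close>, so both spans agree. This lets finite generation, stated for a module with
  shrunken carrier, be used in the ambient module.\<close>

lemma generated_submodule_restrict:
  assumes H: "submodule H R M" and X: "X \<subseteq> H"
  shows "generated_submodule R (M\<lparr>carrier := H\<rparr>) X = generated_submodule R M X"
proof -
  note MH = submodule_left_module[OF H]
  have XM: "X \<subseteq> carrier M" using X submoduleD(1)[OF H] by auto
  note g = generated_submodule_submodule[OF XM]
  have gH: "generated_submodule R M X \<subseteq> H" using generated_submodule_least[OF H X] .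
  then have "submodule (generated_submodule R M X) R (M\<lparr>carrier := H\<rparr>)"
    using submoduleD[OF g] by (intro left_module.submoduleI[OF MH]) auto
  moreover have "submodule N R M" if "submodule N R (M\<lparr>carrier := H\<rparr>)" for N
    using left_module.submoduleD[OF MH that] submoduleD(1)[OF H] by (intro submoduleI) auto
  ultimately show ?thesis using generated_submodule_incl[of X] by (auto simp: generated_submodule_def)
qed

text \<open>Spans are intersections of submodules, whereas independence in \<open>is_basis\<close>
  speaks of finite sums; this is the bridge between the two.\<close>

lemma generated_submodule_combination:
  assumes X: "X \<subseteq> carrier M" and u: "u \<in> generated_submodule R M X"
  obtains Y c where "finite Y" "Y \<subseteq> X" "c \<in> Y \<rightarrow> carrier R" "u = finsum M (\<lambda>y. c y \<odot>\<^bsub>M\<^esub> y) Y"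
proof -
  let ?N = "{finsum M (\<lambda>y. c y \<odot>\<^bsub>M\<^esub> y) Y |Y c. finite Y \<and> Y \<subseteq> X \<and> c \<in> Y \<rightarrow> carrier R}"
  have "submodule ?N R M"
  proof (rule submoduleI)
    show "?N \<subseteq> carrier M" using X by (auto intro!: M.finsum_closed smult_closed)
    show "\<zero>\<^bsub>M\<^esub> \<in> ?N" by (intro CollectI exI[of _ "{}"]) auto
  next
    fix u v assume "u \<in> ?N" "v \<in> ?N"
    then obtain Y c Z d where *: "finite Y" "Y \<subseteq> X" "c \<in> Y \<rightarrow> carrier R"
      "u = finsum M (\<lambda>y. c y \<odot>\<^bsub>M\<^esub> y) Y" "finite Z" "Z \<subseteq> X" "d \<in> Z \<rightarrow> carrier R"
      "v = finsum M (\<lambda>y. d y \<odot>\<^bsub>M\<^esub> y) Z" by blast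
    \<comment> \<open>Extending the coefficients by zero allows both sums to run over
      \<open>Y \<union> Z\<close>.\<close>
    define c' d' where "c' y = (if y \<in> Y then c y else \<zero>\<^bsub>R\<^esub>)"
      and "d' y = (if y \<in> Z then d y else \<zero>\<^bsub>R\<^esub>)" for y
    have cd: "c' y \<in> carrier R" "d' y \<in> carrier R" for y using * by (auto simp: c'_def d'_def)
    have YZ: "Y \<union> Z \<subseteq> carrier M" using * X by auto
    have "u = finsum M (\<lambda>y. c' y \<odot>\<^bsub>M\<^esub> y) (Y \<union> Z)"
      unfolding *(4) using * YZ cd
      by (intro M.add.finprod_mono_neutral_cong_left)
        (auto simp: c'_def smult_zero_left intro!: smult_closed)
    moreover have "v = finsum M (\<lambda>y. d' y \<odot>\<^bsub>M\<^esub> y) (Y \<union> Z)"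
      unfolding *(8) using * YZ cd
      by (intro M.add.finprod_mono_neutral_cong_left)
        (auto simp: d'_def smult_zero_left intro!: smult_closed)
    ultimately have "u \<oplus>\<^bsub>M\<^esub> v = finsum M (\<lambda>y. c' y \<odot>\<^bsub>M\<^esub> y \<oplus>\<^bsub>M\<^esub> d' y \<odot>\<^bsub>M\<^esub> y) (Y \<union> Z)"
      using YZ cd by (subst M.finsum_addf) (auto intro!: smult_closed)
    also have "\<dots> = finsum M (\<lambda>y. (c' y \<oplus>\<^bsub>R\<^esub> d' y) \<odot>\<^bsub>M\<^esub> y) (Y \<union> Z)"
      using YZ cd by (intro M.finsum_cong') (auto simp: smult_l_distr intro!: smult_closed)
    finally show "u \<oplus>\<^bsub>M\<^esub> v \<in> ?N"
      using * cd by (intro CollectI exI[of _ "Y \<union> Z"] exI[of _ "\<lambda>y. c' y \<oplus>\<^bsub>R\<^esub> d' y"]) auto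
  next
    fix a u assume a: "a \<in> carrier R" and "u \<in> ?N"
    then obtain Y c where *: "finite Y" "Y \<subseteq> X" "c \<in> Y \<rightarrow> carrier R"
      "u = finsum M (\<lambda>y. c y \<odot>\<^bsub>M\<^esub> y) Y" by blast
    have "a \<odot>\<^bsub>M\<^esub> finsum M (\<lambda>y. c y \<odot>\<^bsub>M\<^esub> y) Y = finsum M (\<lambda>y. (a \<otimes>\<^bsub>R\<^esub> c y) \<odot>\<^bsub>M\<^esub> y) Y"
      using *(1-3)
    proof (induction Y rule: finite_induct)
      case empty then show ?case using a by (simp add: smult_zero_right)
    next
      case (insert y Y)
      then have "y \<in> carrier M" "Y \<subseteq> carrier M" "c y \<in> carrier R" "c \<in> Y \<rightarrow> carrier R" using X by auto
      then have "(\<lambda>y. c y \<odot>\<^bsub>M\<^esub> y) \<in> Y \<rightarrow> carrier M" "(\<lambda>y. (a \<otimes>\<^bsub>R\<^esub> c y) \<odot>\<^bsub>M\<^esub> y) \<in> Y \<rightarrow> carrier M"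
        using a by (auto intro!: smult_closed)
      then show ?case
        using insert a \<open>y \<in> carrier M\<close> \<open>c y \<in> carrier R\<close>
        by (simp add: smult_r_distr smult_closed smult_assoc1)
    qed
    then show "a \<odot>\<^bsub>M\<^esub> u \<in> ?N"
      unfolding *(4) using * a by (intro CollectI exI[of _ Y] exI[of _ "\<lambda>y. a \<otimes>\<^bsub>R\<^esub> c y"]) auto
  qed
  moreover have "X \<subseteq> ?N"
  proof
    fix y assume "y \<in> X"
    then show "y \<in> ?N" using X
      by (intro CollectI exI[of _ "{y}"] exI[of _ "\<lambda>_. \<one>\<^bsub>R\<^esub>"]) (auto simp: smult_one subset_iff)
  qed
  ultimately have "u \<in> ?N" using u generated_submodule_least[of ?N] by blast
  then show thesis using that by blast
qed

text \<open>\<open>M\<close> is the direct sum of the span of \<open>X - {b}\<close> and the free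
  module on \<open>b\<close>; \<open>h\<close> reads off the coefficient of
  \<open>b\<close>.\<close>

lemma basis_coordinate:
  assumes X: "is_basis R M X" and b: "b \<in> X"
  obtains h where "h \<in> mod_hom R M (regular R)" "h b = \<one>\<^bsub>R\<^esub>"
    "\<And>b'. b' \<in> X \<Longrightarrow> b' \<noteq> b \<Longrightarrow> h b' = \<zero>\<^bsub>R\<^esub>"
proof -
  have XM: "X \<subseteq> carrier M" and gen: "generated_submodule R M X = carrier M"
    using X by (auto simp: is_basis_def)
  have bM: "b \<in> carrier M" and X': "X - {b} \<subseteq> carrier M" using XM b by auto
  let ?W = "generated_submodule R M (X - {b})"
  note W = submoduleD[OF generated_submodule_submodule[OF X']]
  have indep: "d = \<zero>\<^bsub>R\<^esub>" if d: "d \<in> carrier R" "d \<odot>\<^bsub>M\<^esub> b \<in> ?W" for d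
  proof -
    obtain Y c where *: "finite Y" "Y \<subseteq> X - {b}" "c \<in> Y \<rightarrow> carrier R"
      "d \<odot>\<^bsub>M\<^esub> b = finsum M (\<lambda>y. c y \<odot>\<^bsub>M\<^esub> y) Y"
      by (rule generated_submodule_combination[OF X' d(2)])
    \<comment> \<open>Coefficient \<open>- d\<close> at \<open>b\<close> brings \<open>d b\<close>
      to the other side and yields a vanishing combination of basis elements, to which independence
      applies.\<close>
    let ?c = "c(b := \<ominus>\<^bsub>R\<^esub> d)"
    have bY: "b \<notin> Y" using * by auto
    have cl: "(\<lambda>y. c y \<odot>\<^bsub>M\<^esub> y) \<in> Y \<rightarrow> carrier M" using * X' by (auto intro!: smult_closed)
    then have cl': "(\<lambda>y. ?c y \<odot>\<^bsub>M\<^esub> y) \<in> Y \<rightarrow> carrier M" using bY by auto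
    have "finsum M (\<lambda>y. ?c y \<odot>\<^bsub>M\<^esub> y) Y = finsum M (\<lambda>y. c y \<odot>\<^bsub>M\<^esub> y) Y"
      using cl bY by (intro M.finsum_cong') auto
    then have "finsum M (\<lambda>y. ?c y \<odot>\<^bsub>M\<^esub> y) (insert b Y) = \<zero>\<^bsub>M\<^esub>"
      using *(1) cl' bY d bM by (simp add: smult_closed smult_minus_left M.l_neg *(4)[symmetric])
    moreover have "insert b Y \<subseteq> X" "?c \<in> insert b Y \<rightarrow> carrier R" using * b d by auto
    ultimately have "?c b = \<zero>\<^bsub>R\<^esub>" using X *(1) unfolding is_basis_def by blast
    then show ?thesis using d R.add.inv_eq_1_iff by simp
  qed
  have ex: "\<exists>c. c \<in> carrier R \<and> (\<exists>w\<in>?W. u = w \<oplus>\<^bsub>M\<^esub> c \<odot>\<^bsub>M\<^esub> b)" if "u \<in> carrier M" for u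
    using generated_submodule_insert[OF X' bM, of u] gen that b by (metis insert_Diff)
  have uniq: "c = d" if "c \<in> carrier R" "d \<in> carrier R" "w \<in> ?W" "v \<in> ?W"
    "w \<oplus>\<^bsub>M\<^esub> c \<odot>\<^bsub>M\<^esub> b = v \<oplus>\<^bsub>M\<^esub> d \<odot>\<^bsub>M\<^esub> b" for c d w v
  proof -
    have cl: "w \<in> carrier M" "v \<in> carrier M" "c \<odot>\<^bsub>M\<^esub> b \<in> carrier M" "d \<odot>\<^bsub>M\<^esub> b \<in> carrier M"
      using that W(1) bM by (auto intro: smult_closed)
    have "(c \<ominus>\<^bsub>R\<^esub> d) \<odot>\<^bsub>M\<^esub> b = c \<odot>\<^bsub>M\<^esub> b \<ominus>\<^bsub>M\<^esub> d \<odot>\<^bsub>M\<^esub> b"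
      using that bM by (simp add: R.minus_eq M.minus_eq smult_l_distr smult_minus_left)
    also have "\<dots> = (w \<oplus>\<^bsub>M\<^esub> c \<odot>\<^bsub>M\<^esub> b) \<ominus>\<^bsub>M\<^esub> (w \<oplus>\<^bsub>M\<^esub> d \<odot>\<^bsub>M\<^esub> b)"
      using M.add_minus_add_right[OF cl(3,4,1)] cl by (simp add: M.a_comm)
    also have "\<dots> = v \<ominus>\<^bsub>M\<^esub> w"
      using M.add_minus_add_right[OF cl(2,1,4)] by (simp add: that(5))
    also have "\<dots> \<in> ?W" using W that by auto
    finally show ?thesis using indep[of "c \<ominus>\<^bsub>R\<^esub> d"] that by simp
  qed
  \<comment> \<open>By \<open>ex\<close> and \<open>uniq\<close> every element has exactly one
    coefficient at \<open>b\<close>, so the description is proper on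
    \<open>carrier M\<close>.\<close>
  define h where "h u = (THE c. c \<in> carrier R \<and> (\<exists>w\<in>?W. u = w \<oplus>\<^bsub>M\<^esub> c \<odot>\<^bsub>M\<^esub> b))" for u
  have h_eq: "h (w \<oplus>\<^bsub>M\<^esub> c \<odot>\<^bsub>M\<^esub> b) = c" if "w \<in> ?W" "c \<in> carrier R" for w c
    unfolding h_def using that uniq by (intro the_equality) auto
  have "h \<in> mod_hom R M (regular R)"
    unfolding mod_hom_def regular_def
  proof (intro CollectI conjI ballI Pi_I)
    fix u assume u: "u \<in> carrier M"
    obtain w c where *: "w \<in> ?W" "c \<in> carrier R" "u = w \<oplus>\<^bsub>M\<^esub> c \<odot>\<^bsub>M\<^esub> b" using ex[OF u] by auto
    have wM: "w \<in> carrier M" using * W by auto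
    show "h u \<in> carrier \<lparr>carrier = carrier R, monoid.mult = monoid.mult R, one = \<one>\<^bsub>R\<^esub>, zero = \<zero>\<^bsub>R\<^esub>, add = add R, smult = monoid.mult R\<rparr>"
      using * h_eq by simp
    {
      fix v assume v: "v \<in> carrier M"
      obtain w' d where **: "w' \<in> ?W" "d \<in> carrier R" "v = w' \<oplus>\<^bsub>M\<^esub> d \<odot>\<^bsub>M\<^esub> b" using ex[OF v] by auto
      have "w' \<in> carrier M" using ** W by auto
      then have "u \<oplus>\<^bsub>M\<^esub> v = (w \<oplus>\<^bsub>M\<^esub> w') \<oplus>\<^bsub>M\<^esub> (c \<oplus>\<^bsub>R\<^esub> d) \<odot>\<^bsub>M\<^esub> b"
        using * ** wM bM by (simp add: smult_l_distr smult_closed M.a_ac)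
      then show "h (u \<oplus>\<^bsub>M\<^esub> v) = h u \<oplus>\<^bsub>\<lparr>carrier = carrier R, monoid.mult = monoid.mult R, one = \<one>\<^bsub>R\<^esub>, zero = \<zero>\<^bsub>R\<^esub>, add = add R, smult = monoid.mult R\<rparr>\<^esub> h v"
        using * ** h_eq W(3) by simp
    }
    fix a assume a: "a \<in> carrier R"
    have "a \<odot>\<^bsub>M\<^esub> u = a \<odot>\<^bsub>M\<^esub> w \<oplus>\<^bsub>M\<^esub> (a \<otimes>\<^bsub>R\<^esub> c) \<odot>\<^bsub>M\<^esub> b"
      using * a wM bM by (simp add: smult_r_distr smult_closed smult_assoc1)
    then show "h (a \<odot>\<^bsub>M\<^esub> u) = a \<odot>\<^bsub>\<lparr>carrier = carrier R, monoid.mult = monoid.mult R, one = \<one>\<^bsub>R\<^esub>, zero = \<zero>\<^bsub>R\<^esub>, add = add R, smult = monoid.mult R\<rparr>\<^esub> h u"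
      using * a h_eq W(4) by simp
  qed
  moreover have "h b = \<one>\<^bsub>R\<^esub>"
    using h_eq[OF W(2) R.one_closed] bM by (simp add: smult_one)
  moreover have "h b' = \<zero>\<^bsub>R\<^esub>" if "b' \<in> X" "b' \<noteq> b" for b'
  proof -
    have "b' \<in> ?W" "b' \<in> carrier M" using that generated_submodule_incl[of "X - {b}"] XM by auto
    then show ?thesis using h_eq[of b' "\<zero>\<^bsub>R\<^esub>"] bM by (simp add: smult_zero_left)
  qed
  ultimately show thesis using that by blast
qed

end

section \<open>Change of scalars, regular modules and free powers\<close>

lemma left_module_subring:
  assumes "left_module R M" "subring H R"
  shows "left_module (R\<lparr>carrier := H\<rparr>) M"
proof -
  interpret left_module R M by fact
  have "H \<subseteq> carrier R" using R.subring_is_ring[OF assms(2)] subringE(1)[OF assms(2)] by simp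
  then show ?thesis
    using R.subring_is_ring[OF assms(2)] M.abelian_group_axioms
    by (intro left_module.intro left_module_axioms.intro)
      (auto simp: subset_iff smult_closed smult_l_distr smult_r_distr smult_assoc1 smult_one)
qed

lemma left_module_of_module:
  assumes "module K V"
  shows "left_module K V"
proof -
  interpret module K V by fact
  show ?thesis
    by unfold_locales (auto simp: smult_l_distr smult_r_distr smult_assoc1)
qed

lemma (in ring) left_module_regular: "left_module R (regular R)"
proof -
  have "abelian_group (regular R)"
    by (rule abelian_groupI) (auto simp: regular_def a_ac intro: l_neg a_inv_closed)
  then show ?thesis
    using ring_axioms
    by (intro left_module.intro left_module_axioms.intro) (auto simp: regular_def l_distr r_distr m_assoc)
qed

lemma (in ring) left_module_free_power: "left_module R (free_power R n)"
proof -
  have "abelian_group (free_power R n)"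
  proof (rule abelian_groupI)
    fix x assume x: "x \<in> carrier (free_power R n)"
    show "\<exists>y\<in>carrier (free_power R n). y \<oplus>\<^bsub>free_power R n\<^esub> x = \<zero>\<^bsub>free_power R n\<^esub>"
      using x by (intro bexI[of _ "\<lambda>i\<in>{..<n}. \<ominus> x i"])
        (auto simp: free_power_def l_neg PiE_iff fun_eq_iff restrict_def extensional_def)
  qed (auto simp: free_power_def PiE_iff fun_eq_iff extensional_def a_ac)
  then show ?thesis
    using ring_axioms
    by (intro left_module.intro left_module_axioms.intro)
      (auto simp: free_power_def PiE_iff fun_eq_iff extensional_def l_distr r_distr m_assoc)
qed

section \<open>Towers of free extensions\<close>

text \<open>
  What is left of a locally Frobenius algebra: the Frobenius forms and augmentations play no role.
  Right freeness is stated through opposite rings, so that the opposite of a locally Frobenius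
  algebra is again an instance.
\<close>

locale free_tower = frobenius_shape \<Lambda> r l0 + k_algebra K B
  for K :: "'k ring" and B :: "('k, 'a) module"
    and \<Lambda> :: "'l set" and r :: "('l \<times> 'l) set" and l0 :: 'l
    and F :: "'l \<Rightarrow> 'a set" +
  assumes subalgebra: "l \<in> \<Lambda> \<Longrightarrow> k_subalgebra K B (F l)"
    and finite_dimensional: "l \<in> \<Lambda> \<Longrightarrow> finite_dimensional K (B\<lparr>carrier := F l\<rparr>)"
    and proper_inclusion: "\<lbrakk>(l, m) \<in> r; l \<noteq> m\<rbrakk> \<Longrightarrow> F l \<subset> F m"
    and union: "carrier B = (\<Union>l\<in>\<Lambda>. F l)"
    and free_right: "\<lbrakk>(l, m) \<in> r; l \<noteq> m\<rbrakk> \<Longrightarrow>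
      free_module (opposite (B\<lparr>carrier := F l\<rparr>))
        (restrict_scalars id (regular (opposite (B\<lparr>carrier := F m\<rparr>))))"
begin

section \<open>Levels of a tower and right linear functionals between them\<close>

lemma level_in: "(l, m) \<in> r \<Longrightarrow> l \<in> \<Lambda> \<and> m \<in> \<Lambda>"
  using partial_order by (auto simp: partial_order_on_def preorder_on_def refl_on_def)

lemma level_trans: "(l, m) \<in> r \<Longrightarrow> (m, u) \<in> r \<Longrightarrow> (l, u) \<in> r"
  using partial_order by (auto simp: partial_order_on_def preorder_on_def dest: transD)

lemma level_refl: "l \<in> \<Lambda> \<Longrightarrow> (l, l) \<in> r"
  using partial_order by (auto simp: partial_order_on_def preorder_on_def refl_on_def)

lemma F_mono: "(l, m) \<in> r \<Longrightarrow> F l \<subseteq> F m"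
  using proper_inclusion[of l m] by (cases "l = m") auto

lemma F_subring: "l \<in> \<Lambda> \<Longrightarrow> subring (F l) B"
  using subalgebra by (auto simp: k_subalgebra_def)

lemma F_closed:
  assumes "l \<in> \<Lambda>"
  shows "F l \<subseteq> carrier B" "\<zero>\<^bsub>B\<^esub> \<in> F l" "\<one>\<^bsub>B\<^esub> \<in> F l"
    "x \<in> F l \<Longrightarrow> y \<in> F l \<Longrightarrow> x \<oplus>\<^bsub>B\<^esub> y \<in> F l"
    "x \<in> F l \<Longrightarrow> y \<in> F l \<Longrightarrow> x \<otimes>\<^bsub>B\<^esub> y \<in> F l"
    "x \<in> F l \<Longrightarrow> \<ominus>\<^bsub>B\<^esub> x \<in> F l"
    "c \<in> carrier K \<Longrightarrow> c \<odot>\<^bsub>B\<^esub> \<one>\<^bsub>B\<^esub> \<in> F l"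
  using subringE[OF F_subring[OF assms]] subalgebra[OF assms]
  by (auto simp: k_subalgebra_def dest: submodule.smult_closed)

lemma F_carrier: "l \<in> \<Lambda> \<Longrightarrow> x \<in> F l \<Longrightarrow> x \<in> carrier B"
  using F_closed(1) by auto

text \<open>Directedness collects the levels of finitely many elements below one common level. All
  finiteness hypotheses enter through this descent.\<close>

lemma finite_subset_level:
  assumes "finite X" "X \<subseteq> carrier B"
  shows "\<exists>l\<in>\<Lambda>. X \<subseteq> F l"
  using assms
proof (induction X rule: finite_induct)
  case empty
  then show ?case using initial_in by auto
next
  case (insert x X)
  then obtain l m where "l \<in> \<Lambda>" "X \<subseteq> F l" "m \<in> \<Lambda>" "x \<in> F m" using union by auto
  moreover then obtain u where "u \<in> \<Lambda>" "(l, u) \<in> r" "(m, u) \<in> r" using directed by blast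
  ultimately show ?case using F_mono by blast
qed

text \<open>These are the homomorphisms of right \<open>F l\<close>-modules from \<open>F m\<close>
  to \<open>F l\<close>, spelled out inside \<open>B\<close> so that computations avoid opposite
  rings.\<close>

definition right_linear :: "'l \<Rightarrow> 'l \<Rightarrow> ('a \<Rightarrow> 'a) set" where
  "right_linear l m = {\<phi> \<in> F m \<rightarrow> F l.
     (\<forall>x\<in>F m. \<forall>y\<in>F m. \<phi> (x \<oplus>\<^bsub>B\<^esub> y) = \<phi> x \<oplus>\<^bsub>B\<^esub> \<phi> y) \<and>
     (\<forall>x\<in>F m. \<forall>a\<in>F l. \<phi> (x \<otimes>\<^bsub>B\<^esub> a) = \<phi> x \<otimes>\<^bsub>B\<^esub> a)}"

lemma right_linearD:
  assumes "\<phi> \<in> right_linear l m"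
  shows "x \<in> F m \<Longrightarrow> \<phi> x \<in> F l"
    "x \<in> F m \<Longrightarrow> y \<in> F m \<Longrightarrow> \<phi> (x \<oplus>\<^bsub>B\<^esub> y) = \<phi> x \<oplus>\<^bsub>B\<^esub> \<phi> y"
    "x \<in> F m \<Longrightarrow> a \<in> F l \<Longrightarrow> \<phi> (x \<otimes>\<^bsub>B\<^esub> a) = \<phi> x \<otimes>\<^bsub>B\<^esub> a"
  using assms by (auto simp: right_linear_def)

lemma right_linear_zero:
  assumes "\<phi> \<in> right_linear l m" "l \<in> \<Lambda>" "m \<in> \<Lambda>"
  shows "\<phi> \<zero>\<^bsub>B\<^esub> = \<zero>\<^bsub>B\<^esub>"
proof -
  have "\<phi> (\<zero>\<^bsub>B\<^esub> \<otimes>\<^bsub>B\<^esub> \<zero>\<^bsub>B\<^esub>) = \<phi> \<zero>\<^bsub>B\<^esub> \<otimes>\<^bsub>B\<^esub> \<zero>\<^bsub>B\<^esub>"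
    using assms F_closed by (intro right_linearD(3)[OF assms(1)]) auto
  moreover have "\<phi> \<zero>\<^bsub>B\<^esub> \<in> carrier B"
    using right_linearD(1)[OF assms(1)] F_closed assms by blast
  ultimately show ?thesis by simp
qed

text \<open>Left multiplication by \<open>a\<close> commutes with the right action of
  \<open>F l\<close>. Hence the functionals form a right \<open>F m\<close>-module, which handles
  scalars from \<open>F m\<close> in \<open>right_linear_level_span\<close>.\<close>

lemma right_linear_mult_left:
  assumes \<phi>: "\<phi> \<in> right_linear l m" and m: "(l, m) \<in> r" and a: "a \<in> F m"
  shows "(\<lambda>x. \<phi> (a \<otimes>\<^bsub>B\<^esub> x)) \<in> right_linear l m"
proof -
  have L: "l \<in> \<Lambda>" "m \<in> \<Lambda>" using m level_in by auto
  have sub: "x \<in> carrier B" if "x \<in> F m" for x using that F_carrier L by auto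
  have sub': "x \<in> F m" if "x \<in> F l" for x using that F_mono m by auto
  show ?thesis
    unfolding right_linear_def
    using a L sub sub' right_linearD[OF \<phi>] F_closed[OF L(2)]
    by (auto simp: A.r_distr A.m_assoc[symmetric])
qed

text \<open>
  A basis with at most one element \<open>b\<close> is impossible: \<open>1 = b u\<close> with \<open>u \<in> F l\<close>, left multiplication
  by \<open>u\<close> is injective, hence surjective, on \<open>F l\<close>, so \<open>b\<close> lies in \<open>F l\<close> and \<open>F m = F l\<close>.
\<close>

lemma independent_pair:
  assumes lm: "(l, m) \<in> r" "l \<noteq> m"
  obtains b c \<phi> \<psi> where "b \<in> F m" "c \<in> F m" "\<phi> \<in> right_linear l m" "\<psi> \<in> right_linear l m"
    "\<phi> b = \<one>\<^bsub>B\<^esub>" "\<phi> c = \<zero>\<^bsub>B\<^esub>" "\<psi> b = \<zero>\<^bsub>B\<^esub>" "\<psi> c = \<one>\<^bsub>B\<^esub>"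
proof -
  let ?R = "opposite (B\<lparr>carrier := F l\<rparr>)"
  let ?M = "restrict_scalars id (regular (opposite (B\<lparr>carrier := F m\<rparr>)))"
  have L: "l \<in> \<Lambda>" "m \<in> \<Lambda>" using lm level_in by auto
  have hom: "mod_hom ?R ?M (regular ?R) = right_linear l m"
    by (auto simp: mod_hom_def right_linear_def regular_def opposite_def restrict_scalars_def)
  obtain X where X: "is_basis ?R ?M X" and "left_module ?R ?M"
    using free_right[OF lm] by (auto simp: free_module_def)
  then interpret RM: left_module ?R ?M by simp
  have XF: "X \<subseteq> F m" and gen: "generated_submodule ?R ?M X = F m"
    using X by (auto simp: is_basis_def restrict_scalars_def regular_def opposite_def)
  have "\<exists>b\<in>X. \<exists>c\<in>X. b \<noteq> c"
  proof (rule ccontr)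
    assume *: "\<not> ?thesis"
    obtain x where x: "x \<in> F m" "x \<notin> F l" using proper_inclusion[OF lm] by auto
    have "X \<noteq> {}"
    proof
      assume "X = {}"
      then have "F m = {\<zero>\<^bsub>?M\<^esub>}" using gen RM.generated_submodule_empty by simp
      then show False
        using x F_closed(2)[OF L(1)] by (simp add: restrict_scalars_def regular_def opposite_def)
    qed
    then obtain b where b: "X = {b}" using * by auto
    have bm: "b \<in> F m" using XF b by auto
    then have bB: "b \<in> carrier B" using F_carrier L by auto
    \<comment> \<open>Scalars act through the opposite ring, hence from the right, and the span of
      the single element \<open>b\<close> is \<open>b F l\<close>.\<close>
    have span: "\<exists>c\<in>F l. y = b \<otimes>\<^bsub>B\<^esub> c" if y: "y \<in> F m" for y
    proof -
      have "y \<in> generated_submodule ?R ?M (insert b {})" using gen b y by simp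
      moreover have "b \<in> carrier ?M" using bm by (simp add: restrict_scalars_def regular_def opposite_def)
      ultimately obtain w c where "w \<in> generated_submodule ?R ?M {}" "c \<in> carrier ?R"
        "y = w \<oplus>\<^bsub>?M\<^esub> c \<odot>\<^bsub>?M\<^esub> b"
        using RM.generated_submodule_insert[of "{}" b y] by blast
      then have "y = \<zero>\<^bsub>B\<^esub> \<oplus>\<^bsub>B\<^esub> b \<otimes>\<^bsub>B\<^esub> c" "c \<in> F l"
        by (auto simp: RM.generated_submodule_empty)
          (auto simp: restrict_scalars_def regular_def opposite_def)
      moreover then have "b \<otimes>\<^bsub>B\<^esub> c \<in> carrier B" using bB F_carrier L by auto
      ultimately show ?thesis by auto
    qed
    obtain u where u: "u \<in> F l" "\<one>\<^bsub>B\<^esub> = b \<otimes>\<^bsub>B\<^esub> u" using span F_closed(3)[OF L(2)] by blast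
    have uB: "u \<in> carrier B" using u F_carrier L by auto
    \<comment> \<open>Since \<open>b u = 1\<close>, left multiplication by \<open>b\<close> inverts
      left multiplication by \<open>u\<close>, which is therefore injective on
      \<open>F l\<close>.\<close>
    have bu: "b \<otimes>\<^bsub>B\<^esub> (u \<otimes>\<^bsub>B\<^esub> y) = y" if "y \<in> F l" for y
      using that bB uB F_carrier[OF L(1)] u(2)[symmetric] by (simp flip: A.m_assoc)
    obtain Y where Y: "finite Y" "is_basis K (B\<lparr>carrier := F l\<rparr>) Y"
      and "left_module K (B\<lparr>carrier := F l\<rparr>)"
      using finite_dimensional[OF L(1)] left_module_of_module by (auto simp: finite_dimensional_def)
    then interpret Kl: left_module K "B\<lparr>carrier := F l\<rparr>" by simp
    have "(\<lambda>y. u \<otimes>\<^bsub>B\<^esub> y) ` carrier (B\<lparr>carrier := F l\<rparr>) = carrier (B\<lparr>carrier := F l\<rparr>)"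
    proof (rule Kl.inj_endomorphism_surj[OF K.field_axioms Y(1)])
      show "(\<lambda>y. u \<otimes>\<^bsub>B\<^esub> y) \<in> mod_hom K (B\<lparr>carrier := F l\<rparr>) (B\<lparr>carrier := F l\<rparr>)"
        using u uB F_closed[OF L(1)] F_carrier[OF L(1)]
        by (auto simp: mod_hom_def A.r_distr smult_mult_right)
      show "inj_on (\<lambda>y. u \<otimes>\<^bsub>B\<^esub> y) (carrier (B\<lparr>carrier := F l\<rparr>))"
        by (rule inj_on_inverseI[where g = "\<lambda>y. b \<otimes>\<^bsub>B\<^esub> y"]) (simp add: bu)
    qed (use Y in \<open>auto simp: is_basis_def\<close>)
    then have "\<one>\<^bsub>B\<^esub> \<in> (\<lambda>y. u \<otimes>\<^bsub>B\<^esub> y) ` F l" using F_closed(3)[OF L(1)] by simp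
    \<comment> \<open>Now \<open>u\<close> has the left inverse \<open>b\<close> and the right
      inverse \<open>v\<close>, so \<open>b = b (u v) = v\<close> lies in
      \<open>F l\<close>.\<close>
    then obtain v where v: "v \<in> F l" "u \<otimes>\<^bsub>B\<^esub> v = \<one>\<^bsub>B\<^esub>" by auto
    then have "b \<in> F l" using bu[OF v(1)] bB by simp
    then show False using span[OF x(1)] x(2) F_closed[OF L(1)] by auto
  qed
  then obtain b c where bc: "b \<in> X" "c \<in> X" "b \<noteq> c" by auto
  have one: "\<one>\<^bsub>?R\<^esub> = \<one>\<^bsub>B\<^esub>" "\<zero>\<^bsub>?R\<^esub> = \<zero>\<^bsub>B\<^esub>" by (auto simp: opposite_def)
  obtain \<phi> where "\<phi> \<in> right_linear l m" "\<phi> b = \<one>\<^bsub>B\<^esub>" "\<phi> c = \<zero>\<^bsub>B\<^esub>"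
    using RM.basis_coordinate[OF X bc(1)] bc unfolding hom one by metis
  moreover obtain \<psi> where "\<psi> \<in> right_linear l m" "\<psi> c = \<one>\<^bsub>B\<^esub>" "\<psi> b = \<zero>\<^bsub>B\<^esub>"
    using RM.basis_coordinate[OF X bc(2)] bc unfolding hom one by metis
  ultimately show thesis using that bc XF by blast
qed

end

text \<open>A subspace containing a basis is the whole space. This reduces claims about all elements
  of a finite dimensional module to its finitely many basis elements.\<close>

lemma (in k_algebra) subspace_eq_carrier:
  assumes "finite_dimensional K (underlying_space A M)" "is_basis K (underlying_space A M) X" "X \<subseteq> H"
    and H: "H \<subseteq> carrier M" "\<zero>\<^bsub>M\<^esub> \<in> H" "\<And>x y. \<lbrakk>x \<in> H; y \<in> H\<rbrakk> \<Longrightarrow> x \<oplus>\<^bsub>M\<^esub> y \<in> H"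
      "\<And>c x. \<lbrakk>c \<in> carrier K; x \<in> H\<rbrakk> \<Longrightarrow> (c \<odot>\<^bsub>A\<^esub> \<one>\<^bsub>A\<^esub>) \<odot>\<^bsub>M\<^esub> x \<in> H"
  shows "H = carrier M"
proof -
  interpret V: left_module K "underlying_space A M"
    using assms(1) left_module_of_module by (auto simp: finite_dimensional_def)
  have "submodule H K (underlying_space A M)"
    using H by (intro V.submoduleI) (auto simp: underlying_space_def restrict_scalars_def)
  then show ?thesis
    using V.generated_submodule_least[of H X] assms(2,3) H(1)
    by (auto simp: is_basis_def underlying_space_def restrict_scalars_def)
qed

context free_tower
begin

text \<open>This is the common core of both vanishing results. With \<open>t = 0\<close>,
  \<open>cancel\<close> makes multiplication by \<open>b\<close> injective, hence surjective. Every
  \<open>c s\<close> is then some \<open>b t\<close>, and \<open>cancel\<close> with the two members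
  of the pair exchanged gives \<open>s = 0\<close>.\<close>

lemma independent_pair_vanishing:
  assumes "left_module B M" "finite_dimensional K (underlying_space B M)" and lm: "(l, m) \<in> r" "l \<noteq> m"
    and cancel: "\<And>b c \<phi> s t. \<lbrakk>b \<in> F m; c \<in> F m; \<phi> \<in> right_linear l m; \<phi> b = \<one>\<^bsub>B\<^esub>; \<phi> c = \<zero>\<^bsub>B\<^esub>;
      s \<in> carrier M; t \<in> carrier M; b \<odot>\<^bsub>M\<^esub> s = c \<odot>\<^bsub>M\<^esub> t\<rbrakk> \<Longrightarrow> s = \<zero>\<^bsub>M\<^esub>"
  shows "carrier M = {\<zero>\<^bsub>M\<^esub>}"
proof -
  interpret M: left_module B M by fact
  let ?V = "underlying_space B M"
  obtain X where X: "finite X" "is_basis K ?V X" using assms(2) by (auto simp: finite_dimensional_def)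
  have V: "carrier ?V = carrier M" "\<zero>\<^bsub>?V\<^esub> = \<zero>\<^bsub>M\<^esub>"
    by (auto simp: underlying_space_def restrict_scalars_def)
  interpret V: left_module K ?V
    using assms(2) left_module_of_module by (auto simp: finite_dimensional_def)
  obtain b c \<phi> \<psi> where bc: "b \<in> F m" "c \<in> F m" "\<phi> \<in> right_linear l m" "\<psi> \<in> right_linear l m"
    "\<phi> b = \<one>\<^bsub>B\<^esub>" "\<phi> c = \<zero>\<^bsub>B\<^esub>" "\<psi> b = \<zero>\<^bsub>B\<^esub>" "\<psi> c = \<one>\<^bsub>B\<^esub>"
    using independent_pair[OF lm] by metis
  have B: "b \<in> carrier B" "c \<in> carrier B" using bc F_carrier level_in lm by auto
  let ?f = "\<lambda>s. b \<odot>\<^bsub>M\<^esub> s"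
  \<comment> \<open>Elements of \<open>K\<close> act through central elements of \<open>B\<close>,
    so multiplication by \<open>b\<close> is \<open>K\<close>-linear although it need not be
    \<open>B\<close>-linear.\<close>
  have comm: "b \<odot>\<^bsub>M\<^esub> ((k \<odot>\<^bsub>B\<^esub> \<one>\<^bsub>B\<^esub>) \<odot>\<^bsub>M\<^esub> s) = (k \<odot>\<^bsub>B\<^esub> \<one>\<^bsub>B\<^esub>) \<odot>\<^bsub>M\<^esub> (b \<odot>\<^bsub>M\<^esub> s)"
    if "k \<in> carrier K" "s \<in> carrier M" for k s
    using that B by (simp add: smult_mult_left smult_mult_right flip: M.smult_assoc1)
  have f: "?f \<in> mod_hom K ?V ?V"
    using B comm
    by (auto simp: mod_hom_def underlying_space_def restrict_scalars_def M.smult_r_distr intro: M.smult_closed)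
  moreover have "inj_on ?f (carrier ?V)"
  proof (rule V.mod_hom_inj_onI[OF V.left_module_axioms f])
    fix s assume "s \<in> carrier ?V" "b \<odot>\<^bsub>M\<^esub> s = \<zero>\<^bsub>?V\<^esub>"
    then show "s = \<zero>\<^bsub>?V\<^esub>"
      using cancel[OF bc(1,2,3,5,6), of s "\<zero>\<^bsub>M\<^esub>"] B by (simp add: V M.smult_zero_right)
  qed
  ultimately have surj: "?f ` carrier M = carrier M"
    using V.inj_endomorphism_surj[OF K.field_axioms X(1)] X(2) V by (simp add: is_basis_def)
  have "s = \<zero>\<^bsub>M\<^esub>" if s: "s \<in> carrier M" for s
  proof -
    have "c \<odot>\<^bsub>M\<^esub> s \<in> ?f ` carrier M" using surj s B M.smult_closed by simp
    then obtain t where "t \<in> carrier M" "c \<odot>\<^bsub>M\<^esub> s = b \<odot>\<^bsub>M\<^esub> t" by auto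
    then show ?thesis using cancel[OF bc(2,1,4,8,7), of s t] s by simp
  qed
  then show ?thesis by auto
qed

section \<open>Finite dimensional modules over a tower\<close>

lemma no_finite_dimensional_submodule:
  assumes M: "left_module B M" and fd: "finite_dimensional K (underlying_space B M)"
    and h: "h \<in> mod_hom B M (regular B)"
    and inj: "\<And>x. x \<in> carrier M \<Longrightarrow> h x = \<zero>\<^bsub>B\<^esub> \<Longrightarrow> x = \<zero>\<^bsub>M\<^esub>"
  shows "carrier M = {\<zero>\<^bsub>M\<^esub>}"
proof -
  interpret M: left_module B M by fact
  have hD: "\<And>x. x \<in> carrier M \<Longrightarrow> h x \<in> carrier B"
    "\<And>x y. \<lbrakk>x \<in> carrier M; y \<in> carrier M\<rbrakk> \<Longrightarrow> h (x \<oplus>\<^bsub>M\<^esub> y) = h x \<oplus>\<^bsub>B\<^esub> h y"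
    "\<And>x a. \<lbrakk>x \<in> carrier M; a \<in> carrier B\<rbrakk> \<Longrightarrow> h (a \<odot>\<^bsub>M\<^esub> x) = a \<otimes>\<^bsub>B\<^esub> h x"
    using h by (auto simp: mod_hom_def regular_def)
  have h0: "h \<zero>\<^bsub>M\<^esub> = \<zero>\<^bsub>B\<^esub>"
    using M.mod_hom_zero[OF A.left_module_regular h] by (simp add: regular_def)
  obtain X where X: "finite X" "is_basis K (underlying_space B M) X"
    using fd by (auto simp: finite_dimensional_def)
  then have XM: "X \<subseteq> carrier M" by (auto simp: is_basis_def underlying_space_def restrict_scalars_def)
  have "finite (h ` X)" "h ` X \<subseteq> carrier B" using X(1) XM hD(1) by auto
  then obtain l where l: "l \<in> \<Lambda>" "h ` X \<subseteq> F l" using finite_subset_level by blast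
  have "{x \<in> carrier M. h x \<in> F l} = carrier M"
    using XM l F_closed[OF l(1)] F_carrier[OF l(1)] h0
    by (intro subspace_eq_carrier[OF fd X(2)]) (auto simp: hD intro!: M.smult_closed)
  then have hF: "h x \<in> F l" if "x \<in> carrier M" for x using that by auto
  obtain m where lm: "(l, m) \<in> r" "l \<noteq> m" using no_maximal[OF l(1)] by auto
  show ?thesis
  proof (rule independent_pair_vanishing[OF M fd lm])
    fix b c \<phi> s t
    assume *: "b \<in> F m" "c \<in> F m" "\<phi> \<in> right_linear l m" "\<phi> b = \<one>\<^bsub>B\<^esub>" "\<phi> c = \<zero>\<^bsub>B\<^esub>"
      "s \<in> carrier M" "t \<in> carrier M" "b \<odot>\<^bsub>M\<^esub> s = c \<odot>\<^bsub>M\<^esub> t"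
    have B: "b \<in> carrier B" "c \<in> carrier B" using * F_carrier level_in lm by auto
    have "b \<otimes>\<^bsub>B\<^esub> h s = c \<otimes>\<^bsub>B\<^esub> h t" using * B hD(3) by metis
    \<comment> \<open>Right linearity over \<open>F l\<close> applies because \<open>h s\<close> and
      \<open>h t\<close> lie in \<open>F l\<close>.\<close>
    then have "\<phi> b \<otimes>\<^bsub>B\<^esub> h s = \<phi> c \<otimes>\<^bsub>B\<^esub> h t"
      using right_linearD(3)[OF *(3)] *(1,2) hF *(6,7) by metis
    then have "h s = \<zero>\<^bsub>B\<^esub>" using * hD(1) A.one_closed by simp
    then show "s = \<zero>\<^bsub>M\<^esub>" using inj * by simp
  qed
qed

section \<open>Spans in free powers at varying levels\<close>

abbreviation power_level :: "nat \<Rightarrow> 'l \<Rightarrow> (nat \<Rightarrow> 'a) set" where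
  "power_level n l \<equiv> {..<n} \<rightarrow>\<^sub>E F l"

text \<open>The ambient module is \<open>free_power B n\<close> at every level, so spans over
  different \<open>F l\<close> are subsets of one module and can be compared by inclusion.\<close>

abbreviation level_span :: "nat \<Rightarrow> (nat \<Rightarrow> 'a) set \<Rightarrow> 'l \<Rightarrow> (nat \<Rightarrow> 'a) set" where
  "level_span n G l \<equiv> generated_submodule (B\<lparr>carrier := F l\<rparr>) (free_power B n) G"

lemma power_level_subset: "l \<in> \<Lambda> \<Longrightarrow> power_level n l \<subseteq> carrier (free_power B n)"
  using F_closed(1) by (auto simp: free_power_def)

lemma power_level_mono: "(l, m) \<in> r \<Longrightarrow> power_level n l \<subseteq> power_level n m"
  using F_mono by (auto simp: PiE_iff)

lemma finite_subset_power_level: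
  assumes "finite G" "G \<subseteq> carrier (free_power B n)"
  shows "\<exists>l\<in>\<Lambda>. G \<subseteq> power_level n l"
proof -
  define U where "U = (\<Union>g\<in>G. g ` {..<n})"
  have "g i \<in> carrier B" if "g \<in> G" "i < n" for g i
    using subsetD[OF assms(2) that(1)] that(2) by (auto simp: free_power_def PiE_iff)
  then have "finite U" "U \<subseteq> carrier B" using assms(1) by (auto simp: U_def)
  then obtain l where l: "l \<in> \<Lambda>" "U \<subseteq> F l" using finite_subset_level by blast
  have "g \<in> power_level n l" if "g \<in> G" for g
    using subsetD[OF assms(2) that] that l(2) by (auto simp: U_def free_power_def PiE_iff)
  then show ?thesis using l(1) by auto
qed

lemma left_module_level_power: "l \<in> \<Lambda> \<Longrightarrow> left_module (B\<lparr>carrier := F l\<rparr>) (free_power B n)"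
  by (intro left_module_subring A.left_module_free_power F_subring)

lemma power_level_closed:
  assumes "l \<in> \<Lambda>"
  shows "\<zero>\<^bsub>free_power B n\<^esub> \<in> power_level n l"
    "\<lbrakk>v \<in> power_level n l; w \<in> power_level n l\<rbrakk> \<Longrightarrow> v \<oplus>\<^bsub>free_power B n\<^esub> w \<in> power_level n l"
    "\<lbrakk>a \<in> F l; v \<in> power_level n l\<rbrakk> \<Longrightarrow> a \<odot>\<^bsub>free_power B n\<^esub> v \<in> power_level n l"
  using F_closed[OF assms] by (auto simp: free_power_def PiE_iff)

lemma level_span_closed:
  assumes l: "l \<in> \<Lambda>" and G: "G \<subseteq> carrier (free_power B n)"
  shows "level_span n G l \<subseteq> carrier (free_power B n)" "\<zero>\<^bsub>free_power B n\<^esub> \<in> level_span n G l"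
    "G \<subseteq> level_span n G l"
    "\<lbrakk>v \<in> level_span n G l; w \<in> level_span n G l\<rbrakk> \<Longrightarrow> v \<oplus>\<^bsub>free_power B n\<^esub> w \<in> level_span n G l"
    "\<lbrakk>a \<in> F l; v \<in> level_span n G l\<rbrakk> \<Longrightarrow> a \<odot>\<^bsub>free_power B n\<^esub> v \<in> level_span n G l"
proof -
  interpret lev: left_module "B\<lparr>carrier := F l\<rparr>" "free_power B n" by (rule left_module_level_power[OF l])
  note span = lev.submoduleD(1-4)[OF lev.generated_submodule_submodule[OF G]] lev.generated_submodule_incl[of G]
  show "level_span n G l \<subseteq> carrier (free_power B n)" "\<zero>\<^bsub>free_power B n\<^esub> \<in> level_span n G l"
    "G \<subseteq> level_span n G l"
    "\<lbrakk>v \<in> level_span n G l; w \<in> level_span n G l\<rbrakk> \<Longrightarrow> v \<oplus>\<^bsub>free_power B n\<^esub> w \<in> level_span n G l"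
    "\<lbrakk>a \<in> F l; v \<in> level_span n G l\<rbrakk> \<Longrightarrow> a \<odot>\<^bsub>free_power B n\<^esub> v \<in> level_span n G l"
    using span by simp_all
qed

lemma level_span_least:
  assumes l: "l \<in> \<Lambda>" and N: "N \<subseteq> carrier (free_power B n)" "\<zero>\<^bsub>free_power B n\<^esub> \<in> N"
    "\<And>v w. \<lbrakk>v \<in> N; w \<in> N\<rbrakk> \<Longrightarrow> v \<oplus>\<^bsub>free_power B n\<^esub> w \<in> N"
    "\<And>a v. \<lbrakk>a \<in> F l; v \<in> N\<rbrakk> \<Longrightarrow> a \<odot>\<^bsub>free_power B n\<^esub> v \<in> N"
    and G: "G \<subseteq> N"
  shows "level_span n G l \<subseteq> N"
proof -
  interpret lev: left_module "B\<lparr>carrier := F l\<rparr>" "free_power B n" by (rule left_module_level_power[OF l])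
  show ?thesis using N by (intro lev.generated_submodule_least[OF _ G] lev.submoduleI) auto
qed

lemma level_span_mono:
  assumes "(l, m) \<in> r" "G \<subseteq> carrier (free_power B n)"
  shows "level_span n G l \<subseteq> level_span n G m"
proof -
  have L: "l \<in> \<Lambda>" "m \<in> \<Lambda>" using assms level_in by auto
  note span = level_span_closed[OF L(2) assms(2)]
  show ?thesis using span F_mono[OF assms(1)] by (intro level_span_least[OF L(1)]) auto
qed

text \<open>A combination of elements \<open>g\<close> of \<open>G\<close> with coefficients
  \<open>a g\<close> in \<open>F m\<close> is sent to the one with coefficients
  \<open>\<phi> (a g)\<close>, because the entries of \<open>G\<close> lie in
  \<open>F l\<close>.\<close>

lemma right_linear_level_span:
  assumes lm: "(l, m) \<in> r" and G: "G \<subseteq> power_level n l"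
    and v: "v \<in> level_span n G m" and \<phi>: "\<phi> \<in> right_linear l m"
  shows "(\<lambda>i\<in>{..<n}. \<phi> (v i)) \<in> level_span n G l"
proof -
  let ?P = "free_power B n"
  \<comment> \<open>All functionals are quantified at once: closure under the scalar
    \<open>a\<close> trades \<open>\<phi>\<close> for the functional sending \<open>x\<close> to
    \<open>\<phi> (a x)\<close>.\<close>
  let ?N = "{v \<in> power_level n m. \<forall>\<phi>\<in>right_linear l m. (\<lambda>i\<in>{..<n}. \<phi> (v i)) \<in> level_span n G l}"
  have L: "l \<in> \<Lambda>" "m \<in> \<Lambda>" using lm level_in by auto
  have GP: "G \<subseteq> carrier ?P" using G power_level_subset L by blast
  note span = level_span_closed[OF L(1) GP]
  note pl = power_level_closed[OF L(2), where n = n]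
  have "level_span n G m \<subseteq> ?N"
  proof (rule level_span_least[OF L(2)])
    show "?N \<subseteq> carrier ?P" using power_level_subset[OF L(2)] by auto
    have "(\<lambda>i\<in>{..<n}. \<phi> (\<zero>\<^bsub>?P\<^esub> i)) = \<zero>\<^bsub>?P\<^esub>" if "\<phi> \<in> right_linear l m" for \<phi>
      using right_linear_zero[OF that L] by (auto simp: free_power_def)
    then show "\<zero>\<^bsub>?P\<^esub> \<in> ?N" using pl(1) span(2) by simp
  next
    fix x y assume xy: "x \<in> ?N" "y \<in> ?N"
    have "(\<lambda>i\<in>{..<n}. \<phi> ((x \<oplus>\<^bsub>?P\<^esub> y) i)) = (\<lambda>i\<in>{..<n}. \<phi> (x i)) \<oplus>\<^bsub>?P\<^esub> (\<lambda>i\<in>{..<n}. \<phi> (y i))"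
      if "\<phi> \<in> right_linear l m" for \<phi>
      using xy by (auto simp: free_power_def PiE_iff right_linearD(2)[OF that])
    then show "x \<oplus>\<^bsub>?P\<^esub> y \<in> ?N" using xy pl(2) span(4) by simp
  next
    fix a x assume a: "a \<in> F m" and x: "x \<in> ?N"
    have "(\<lambda>i\<in>{..<n}. \<phi> ((a \<odot>\<^bsub>?P\<^esub> x) i)) \<in> level_span n G l"
      if "\<phi> \<in> right_linear l m" for \<phi>
    proof -
      have "(\<lambda>i\<in>{..<n}. \<phi> ((a \<odot>\<^bsub>?P\<^esub> x) i)) = (\<lambda>i\<in>{..<n}. \<phi> (a \<otimes>\<^bsub>B\<^esub> x i))"
        by (auto simp: free_power_def)
      moreover have "\<forall>\<phi>\<in>right_linear l m. (\<lambda>i\<in>{..<n}. \<phi> (x i)) \<in> level_span n G l" using x by simp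
      from bspec[OF this right_linear_mult_left[OF that lm a]]
      have "(\<lambda>i\<in>{..<n}. \<phi> (a \<otimes>\<^bsub>B\<^esub> x i)) \<in> level_span n G l" .
      ultimately show ?thesis by (simp only:)
    qed
    then show "a \<odot>\<^bsub>?P\<^esub> x \<in> ?N" using x pl(3)[OF a] by simp
  next
    show "G \<subseteq> ?N"
    proof
      fix g assume g: "g \<in> G"
      have "(\<lambda>i\<in>{..<n}. \<phi> (g i)) \<in> level_span n G l" if \<phi>: "\<phi> \<in> right_linear l m" for \<phi>
      proof -
        \<comment> \<open>Write \<open>g i\<close> as \<open>1 (g i)\<close> and pull the entry out
          on the right.\<close>
        have "\<phi> (g i) = \<phi> \<one>\<^bsub>B\<^esub> \<otimes>\<^bsub>B\<^esub> g i" if "i < n" for i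
          using right_linearD(3)[OF \<phi> F_closed(3)[OF L(2)], of "g i"] g G that F_carrier[OF L(1)]
          by (auto simp: PiE_iff subset_iff)
        then have "(\<lambda>i\<in>{..<n}. \<phi> (g i)) = \<phi> \<one>\<^bsub>B\<^esub> \<odot>\<^bsub>?P\<^esub> g"
          by (auto simp: free_power_def)
        moreover have "\<phi> \<one>\<^bsub>B\<^esub> \<in> F l" using right_linearD(1)[OF \<phi>] F_closed(3) L by blast
        ultimately show ?thesis using span(3,5) g by auto
      qed
      then show "g \<in> ?N" using g G power_level_mono[OF lm] by blast
    qed
  qed
  then show ?thesis using \<phi> v by blast
qed

text \<open>The span over \<open>B\<close> is the directed union of the spans over the levels above
  \<open>l\<close>. Staying above \<open>l\<close> provides functionals back down to
  \<open>F l\<close>.\<close>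

lemma generated_submodule_levels:
  assumes l: "l \<in> \<Lambda>" and G: "G \<subseteq> carrier (free_power B n)" and v: "v \<in> generated_submodule B (free_power B n) G"
  shows "\<exists>m. (l, m) \<in> r \<and> v \<in> level_span n G m"
proof -
  let ?P = "free_power B n"
  let ?N = "\<Union>m\<in>{m. (l, m) \<in> r}. level_span n G m"
  interpret P: left_module B ?P by (rule A.left_module_free_power)
  note span = level_span_closed[OF _ G]
  have "submodule ?N B ?P"
  proof (rule P.submoduleI)
    show "?N \<subseteq> carrier ?P" using span(1) level_in by blast
    show "\<zero>\<^bsub>?P\<^esub> \<in> ?N" using span(2) level_refl[OF l] l by blast
  next
    fix x y assume "x \<in> ?N" "y \<in> ?N"
    then obtain m k where *: "(l, m) \<in> r" "x \<in> level_span n G m" "(l, k) \<in> r" "y \<in> level_span n G k" by auto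
    then obtain u where u: "u \<in> \<Lambda>" "(m, u) \<in> r" "(k, u) \<in> r" using directed level_in by metis
    then have "x \<in> level_span n G u" "y \<in> level_span n G u" using * level_span_mono[OF _ G] by blast+
    then show "x \<oplus>\<^bsub>?P\<^esub> y \<in> ?N" using span(4)[OF u(1)] level_trans[OF *(1) u(2)] by auto
  next
    fix a x assume "a \<in> carrier B" "x \<in> ?N"
    then obtain m k where *: "(l, m) \<in> r" "x \<in> level_span n G m" "k \<in> \<Lambda>" "a \<in> F k"
      using union by auto
    then obtain u where u: "u \<in> \<Lambda>" "(m, u) \<in> r" "(k, u) \<in> r" using directed level_in by metis
    then have "x \<in> level_span n G u" "a \<in> F u" using * level_span_mono[OF _ G] F_mono by blast+
    then show "a \<odot>\<^bsub>?P\<^esub> x \<in> ?N" using span(5)[OF u(1)] level_trans[OF *(1) u(2)] by auto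
  qed
  moreover have "G \<subseteq> ?N" using span(3)[OF l] level_refl[OF l] by auto
  ultimately show ?thesis using v P.generated_submodule_least[of ?N G] by auto
qed

text \<open>
  This is faithful flatness of \<open>F m\<close> over \<open>F l\<close>: multiply by \<open>b\<close>, then apply \<open>\<phi>\<close> with \<open>\<phi> b = 1\<close>.
\<close>

lemma level_span_faithful:
  assumes l: "l \<in> \<Lambda>" and G: "G \<subseteq> power_level n l" and v: "v \<in> power_level n l"
    and vG: "v \<in> generated_submodule B (free_power B n) G"
  shows "v \<in> level_span n G l"
proof -
  have GP: "G \<subseteq> carrier (free_power B n)" using G power_level_subset[OF l] by blast
  obtain m where m: "(l, m) \<in> r" "v \<in> level_span n G m"
    using generated_submodule_levels[OF l GP vG] by auto
  show ?thesis
  proof (cases "l = m")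
    case True
    then show ?thesis using m by simp
  next
    case False
    obtain b c \<phi> \<psi> where b: "b \<in> F m" "\<phi> \<in> right_linear l m" "\<phi> b = \<one>\<^bsub>B\<^esub>"
      using independent_pair[OF m(1) False] by metis
    have L: "m \<in> \<Lambda>" using m level_in by auto
    have "b \<odot>\<^bsub>free_power B n\<^esub> v \<in> level_span n G m"
      using level_span_closed(5)[OF L GP b(1) m(2)] .
    then have "(\<lambda>i\<in>{..<n}. \<phi> ((b \<odot>\<^bsub>free_power B n\<^esub> v) i)) \<in> level_span n G l"
      by (rule right_linear_level_span[OF m(1) G _ b(2)])
    \<comment> \<open>Entrywise, \<open>\<phi> (b (v i)) = \<phi> b (v i) = v i\<close>, so
      \<open>v\<close> itself is recovered.\<close>
    moreover have "\<phi> ((b \<odot>\<^bsub>free_power B n\<^esub> v) i) = v i" if "i < n" for i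
      using right_linearD(3)[OF b(2,1)] v that b(3) F_carrier[OF l] by (auto simp: free_power_def PiE_iff)
    then have "(\<lambda>i\<in>{..<n}. \<phi> ((b \<odot>\<^bsub>free_power B n\<^esub> v) i)) = v"
      using v by (auto simp: PiE_iff extensional_def)
    ultimately show ?thesis by simp
  qed
qed

text \<open>
  The module is carried by an injection \<open>h\<close> onto the presented submodule of \<open>N\<close>, which saves transporting
  presentations along isomorphisms.
\<close>

lemma no_finite_dimensional_finitely_presented:
  assumes M: "left_module B M" and fd: "finite_dimensional K (underlying_space B M)"
    and N: "left_module B N" and h: "h \<in> mod_hom B M N"
    and inj: "\<And>x. x \<in> carrier M \<Longrightarrow> h x = \<zero>\<^bsub>N\<^esub> \<Longrightarrow> x = \<zero>\<^bsub>M\<^esub>"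
    and p: "p \<in> mod_hom B (free_power B n) N"
    and image: "p ` carrier (free_power B n) = h ` carrier M"
    and kernel: "finitely_generated B
      ((free_power B n)\<lparr>carrier := {v \<in> carrier (free_power B n). p v = \<zero>\<^bsub>N\<^esub>}\<rparr>)"
  shows "carrier M = {\<zero>\<^bsub>M\<^esub>}"
proof -
  let ?P = "free_power B n" and ?k = "{v \<in> carrier (free_power B n). p v = \<zero>\<^bsub>N\<^esub>}"
  interpret M: left_module B M by fact
  interpret N: left_module B N by fact
  interpret P: left_module B ?P by (rule A.left_module_free_power)
  have hD: "\<And>x. x \<in> carrier M \<Longrightarrow> h x \<in> carrier N"
    "\<And>x y. \<lbrakk>x \<in> carrier M; y \<in> carrier M\<rbrakk> \<Longrightarrow> h (x \<oplus>\<^bsub>M\<^esub> y) = h x \<oplus>\<^bsub>N\<^esub> h y"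
    "\<And>x a. \<lbrakk>x \<in> carrier M; a \<in> carrier B\<rbrakk> \<Longrightarrow> h (a \<odot>\<^bsub>M\<^esub> x) = a \<odot>\<^bsub>N\<^esub> h x"
    using h by (auto simp: mod_hom_def)
  have pD: "\<And>x. x \<in> carrier ?P \<Longrightarrow> p x \<in> carrier N"
    "\<And>x y. \<lbrakk>x \<in> carrier ?P; y \<in> carrier ?P\<rbrakk> \<Longrightarrow> p (x \<oplus>\<^bsub>?P\<^esub> y) = p x \<oplus>\<^bsub>N\<^esub> p y"
    "\<And>x a. \<lbrakk>x \<in> carrier ?P; a \<in> carrier B\<rbrakk> \<Longrightarrow> p (a \<odot>\<^bsub>?P\<^esub> x) = a \<odot>\<^bsub>N\<^esub> p x"
    using p by (auto simp: mod_hom_def)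
  have ksub: "submodule ?k B ?P" by (rule P.mod_hom_kernel_submodule[OF N p])
  obtain G where G: "finite G" "G \<subseteq> ?k" "generated_submodule B (?P\<lparr>carrier := ?k\<rparr>) G = ?k"
    using kernel by (auto simp: finitely_generated_def)
  have GP: "G \<subseteq> carrier ?P" using G by auto
  have kgen: "?k \<subseteq> generated_submodule B ?P G"
using G(3) P.generated_submodule_restrict[OF ksub G(2)] by simp
  obtain X where X: "finite X" "is_basis K (underlying_space B M) X"
    using fd by (auto simp: finite_dimensional_def)
  then have XM: "X \<subseteq> carrier M" by (auto simp: is_basis_def underlying_space_def restrict_scalars_def)
  have "\<exists>v. v \<in> carrier ?P \<and> p v = h x" if "x \<in> X" for x
  proof -
    have "h x \<in> p ` carrier ?P" using XM that image by auto
    then show ?thesis by auto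
  qed
  then obtain q where q: "\<And>x. x \<in> X \<Longrightarrow> q x \<in> carrier ?P \<and> p (q x) = h x" by metis
  obtain l where l: "l \<in> \<Lambda>" "G \<union> q ` X \<subseteq> power_level n l"
    using finite_subset_power_level[of "G \<union> q ` X" n] G(1) X(1) GP q
    by (metis Un_subset_iff finite_Un finite_imageI image_subsetI)
  note pl_sub = power_level_subset[OF l(1), of n]
  note pl = power_level_closed[OF l(1), where n = n]
  \<comment> \<open>Elements with a lift at level \<open>l\<close> form a subspace, as
    \<open>K\<close> acts through scalars in \<open>F l\<close>; the lifts \<open>q x\<close> show
    that it contains the basis.\<close>
  have "{x \<in> carrier M. \<exists>v\<in>power_level n l. p v = h x} = carrier M"
  proof (rule subspace_eq_carrier[OF fd X(2)])
    have "p \<zero>\<^bsub>?P\<^esub> = h \<zero>\<^bsub>M\<^esub>" using M.mod_hom_zero[OF N h] P.mod_hom_zero[OF N p] by metis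
    then show "\<zero>\<^bsub>M\<^esub> \<in> {x \<in> carrier M. \<exists>v\<in>power_level n l. p v = h x}" using pl(1) by auto
    show "X \<subseteq> {x \<in> carrier M. \<exists>v\<in>power_level n l. p v = h x}"
      using XM q l(2) by blast
  next
    fix x y assume "x \<in> {x \<in> carrier M. \<exists>v\<in>power_level n l. p v = h x}"
      "y \<in> {x \<in> carrier M. \<exists>v\<in>power_level n l. p v = h x}"
    then obtain v w where *: "x \<in> carrier M" "y \<in> carrier M" "v \<in> power_level n l" "p v = h x"
      "w \<in> power_level n l" "p w = h y" by auto
    then have "p (v \<oplus>\<^bsub>?P\<^esub> w) = h (x \<oplus>\<^bsub>M\<^esub> y)"
      using pD(2)[of v w] hD(2)[of x y] pl_sub by auto
    then show "x \<oplus>\<^bsub>M\<^esub> y \<in> {x \<in> carrier M. \<exists>v\<in>power_level n l. p v = h x}"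
      using *(1,2) pl(2)[OF *(3,5)] by (intro CollectI conjI bexI[of _ "v \<oplus>\<^bsub>?P\<^esub> w"]) simp_all
  next
    fix c x assume c: "c \<in> carrier K" and "x \<in> {x \<in> carrier M. \<exists>v\<in>power_level n l. p v = h x}"
    then obtain v where *: "x \<in> carrier M" "v \<in> power_level n l" "p v = h x" by auto
    let ?c = "c \<odot>\<^bsub>B\<^esub> \<one>\<^bsub>B\<^esub>"
    have cl: "?c \<in> carrier B" "?c \<in> F l" using c F_closed(7)[OF l(1) c] F_carrier[OF l(1)] by auto
    have "p (?c \<odot>\<^bsub>?P\<^esub> v) = h (?c \<odot>\<^bsub>M\<^esub> x)"
      using *(1,3) pD(3)[OF subsetD[OF pl_sub *(2)] cl(1)] hD(3)[OF *(1) cl(1)] by simp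
    then show "?c \<odot>\<^bsub>M\<^esub> x \<in> {x \<in> carrier M. \<exists>v\<in>power_level n l. p v = h x}"
      using pl(3)[OF cl(2) *(2)] M.smult_closed[OF cl(1) *(1)]
      by (intro CollectI conjI bexI[of _ "?c \<odot>\<^bsub>?P\<^esub> v"])
  qed auto
  then have lift: "\<exists>v\<in>power_level n l. p v = h x" if "x \<in> carrier M" for x using that by auto
  obtain m where lm: "(l, m) \<in> r" "l \<noteq> m" using no_maximal[OF l(1)] by auto
  have L: "m \<in> \<Lambda>" using lm level_in by auto
  note plm = power_level_closed[OF L, where n = n]
  show ?thesis
  proof (rule independent_pair_vanishing[OF M fd lm])
    fix b c \<phi> s t
    assume *: "b \<in> F m" "c \<in> F m" "\<phi> \<in> right_linear l m" "\<phi> b = \<one>\<^bsub>B\<^esub>" "\<phi> c = \<zero>\<^bsub>B\<^esub>"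
      "s \<in> carrier M" "t \<in> carrier M" "b \<odot>\<^bsub>M\<^esub> s = c \<odot>\<^bsub>M\<^esub> t"
    have B: "b \<in> carrier B" "c \<in> carrier B" using * F_carrier L by auto
    obtain v w where vw: "v \<in> power_level n l" "p v = h s" "w \<in> power_level n l" "p w = h t"
      using lift *(6,7) by metis
    have vwP: "v \<in> carrier ?P" "w \<in> carrier ?P" using vw pl_sub by auto
    have vwF: "v i \<in> F l" "w i \<in> F l" if "i < n" for i using vw that by (auto simp: PiE_iff)
    \<comment> \<open>Its image under \<open>p\<close> is \<open>h (b s) - h (c t) = 0\<close>. The
      sign is put on \<open>w\<close>, so that \<open>b\<close> and \<open>c\<close> meet entries in
      \<open>F l\<close> from the left and \<open>\<phi>\<close> can be evaluated.\<close>
    let ?z = "b \<odot>\<^bsub>?P\<^esub> v \<oplus>\<^bsub>?P\<^esub> c \<odot>\<^bsub>?P\<^esub> (\<ominus>\<^bsub>B\<^esub> \<one>\<^bsub>B\<^esub> \<odot>\<^bsub>?P\<^esub> w)"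
    have nw: "\<ominus>\<^bsub>B\<^esub> \<one>\<^bsub>B\<^esub> \<odot>\<^bsub>?P\<^esub> w \<in> power_level n l"
      using pl(3)[OF _ vw(3)] F_closed[OF l(1)] by simp
    have "p ?z = b \<odot>\<^bsub>N\<^esub> h s \<oplus>\<^bsub>N\<^esub> c \<odot>\<^bsub>N\<^esub> (\<ominus>\<^bsub>B\<^esub> \<one>\<^bsub>B\<^esub> \<odot>\<^bsub>N\<^esub> h t)"
      using vwP B vw by (simp add: pD P.smult_closed)
    also have "\<dots> = b \<odot>\<^bsub>N\<^esub> h s \<oplus>\<^bsub>N\<^esub> \<ominus>\<^bsub>B\<^esub> \<one>\<^bsub>B\<^esub> \<odot>\<^bsub>N\<^esub> (c \<odot>\<^bsub>N\<^esub> h t)"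
      using B hD(1)[OF *(7)]
      by (simp add: A.r_minus A.l_minus flip: N.smult_assoc1)
    also have "\<dots> = \<zero>\<^bsub>N\<^esub>"
    proof -
      have "b \<odot>\<^bsub>N\<^esub> h s = c \<odot>\<^bsub>N\<^esub> h t" using * B hD(3) by metis
      moreover have "c \<odot>\<^bsub>N\<^esub> h t \<in> carrier N"
        using B hD(1)[OF *(7)] by (auto intro: N.smult_closed)
      ultimately show ?thesis by (simp add: N.minus_one_smult N.r_neg)
    qed
    finally have "p ?z = \<zero>\<^bsub>N\<^esub>" .
    moreover have z: "?z \<in> power_level n m"
      using subsetD[OF power_level_mono[OF lm(1)] vw(1)] subsetD[OF power_level_mono[OF lm(1)] nw]
      by (intro plm(2) plm(3)[OF *(1)] plm(3)[OF *(2)])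
    ultimately have "?z \<in> ?k" using subsetD[OF power_level_subset[OF L] z] by simp
    then have zG: "?z \<in> generated_submodule B ?P G" using kgen by (rule subsetD[rotated])
    have G': "G \<subseteq> power_level n l" "G \<subseteq> power_level n m"
      using l(2) order_trans[OF _ power_level_mono[OF lm(1), of n]] by simp_all
    \<comment> \<open>Faithfulness at level \<open>m\<close> first expresses the relation
      \<open>?z\<close> over \<open>F m\<close>; then \<open>\<phi>\<close> carries it to a relation
      over \<open>F l\<close>, which turns out to be \<open>v\<close>.\<close>
    have "(\<lambda>i\<in>{..<n}. \<phi> (?z i)) \<in> level_span n G l"
      by (rule right_linear_level_span[OF lm(1) G'(1) level_span_faithful[OF L G'(2) z zG] *(3)])
    moreover have "\<phi> (?z i) = v i" if i: "i < n" for i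
    proof -
      let ?w = "\<ominus>\<^bsub>B\<^esub> \<one>\<^bsub>B\<^esub> \<otimes>\<^bsub>B\<^esub> w i"
      have w: "?w \<in> F l" "?w \<in> F m" "v i \<in> F m"
        using vwF[OF i] F_closed[OF l(1)] F_mono[OF lm(1)] by auto
      have "?z i = b \<otimes>\<^bsub>B\<^esub> v i \<oplus>\<^bsub>B\<^esub> c \<otimes>\<^bsub>B\<^esub> ?w" using i by (simp add: free_power_def)
      also have "\<phi> \<dots> = \<phi> b \<otimes>\<^bsub>B\<^esub> v i \<oplus>\<^bsub>B\<^esub> \<phi> c \<otimes>\<^bsub>B\<^esub> ?w"
        using w vwF[OF i] * F_closed(5)[OF L] by (simp add: right_linearD(2,3)[OF *(3)])
      also have "\<dots> = v i"
        using * F_carrier[OF l(1) w(1)] F_carrier[OF l(1) vwF(1)[OF i]] by simp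
      finally show ?thesis .
    qed
    then have "(\<lambda>i\<in>{..<n}. \<phi> (?z i)) = v" using vw(1) by (auto simp: PiE_iff extensional_def)
    ultimately have "v \<in> level_span n G l" by simp
    \<comment> \<open>Thus the lift \<open>v\<close> of \<open>s\<close> is itself a relation, and
      \<open>h s = p v = 0\<close>.\<close>
    moreover have "level_span n G l \<subseteq> ?k"
      using P.submoduleD(1-4)[OF ksub] F_carrier[OF l(1)] G(2) by (intro level_span_least[OF l(1)]) blast+
    ultimately have "v \<in> ?k" by blast
    then show "s = \<zero>\<^bsub>M\<^esub>" using vw inj * by simp
  qed
qed

end

section \<open>Simple modules\<close>

text \<open>The kernel is a submodule missing \<open>y\<close>, so simplicity forces it to be zero.
  The elementwise form matches the injectivity hypotheses of the vanishing results.\<close>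

lemma simple_module_mod_hom_inj:
  assumes S: "simple_module R M" and N: "left_module R N" and h: "h \<in> mod_hom R M N"
    and nz: "y \<in> carrier M" "h y \<noteq> \<zero>\<^bsub>N\<^esub>" and x: "x \<in> carrier M" "h x = \<zero>\<^bsub>N\<^esub>"
  shows "x = \<zero>\<^bsub>M\<^esub>"
proof -
  have "left_module R M" using S by (simp add: simple_module_def)
  then have "submodule {x \<in> carrier M. h x = \<zero>\<^bsub>N\<^esub>} R M"
    by (rule left_module.mod_hom_kernel_submodule[OF _ N h])
  then have "{x \<in> carrier M. h x = \<zero>\<^bsub>N\<^esub>} = {\<zero>\<^bsub>M\<^esub>} \<or> {x \<in> carrier M. h x = \<zero>\<^bsub>N\<^esub>} = carrier M"
    using S unfolding simple_module_def by blast
  then show ?thesis using nz x by blast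
qed

context free_tower
begin

lemma simple_hom_vanishes_regular:
  assumes S: "simple_module B S" and fd: "finite_dimensional K (underlying_space B S)"
  shows "hom_vanishes B S (regular B)"
proof (rule ccontr)
  have M: "left_module B S" and nz: "carrier S \<noteq> {\<zero>\<^bsub>S\<^esub>}" using S by (auto simp: simple_module_def)
  assume "\<not> ?thesis"
  then obtain h y where h: "h \<in> mod_hom B S (regular B)" "y \<in> carrier S" "h y \<noteq> \<zero>\<^bsub>regular B\<^esub>"
    by (auto simp: hom_vanishes_def)
  have "x = \<zero>\<^bsub>S\<^esub>" if "x \<in> carrier S" "h x = \<zero>\<^bsub>B\<^esub>" for x
    using simple_module_mod_hom_inj[OF S A.left_module_regular h] that by (simp add: regular_def)
  then show False using no_finite_dimensional_submodule[OF M fd h(1)] nz by blast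
qed

text \<open>Followed by the inclusion, such an isomorphism is an injective map that must vanish, so
  \<open>S\<close> would have only one element.\<close>

lemma simple_not_iso_submodule:
  assumes S: "simple_module B S" and fd: "finite_dimensional K (underlying_space B S)"
    and N: "submodule N B (regular B)"
  shows "\<not> mod_iso B S ((regular B)\<lparr>carrier := N\<rparr>)"
proof
  interpret reg: left_module B "regular B" by (rule A.left_module_regular)
  assume "mod_iso B S ((regular B)\<lparr>carrier := N\<rparr>)"
  then obtain h where h: "h \<in> mod_hom B S ((regular B)\<lparr>carrier := N\<rparr>)" "inj_on h (carrier S)"
    by (auto simp: mod_iso_def bij_betw_def)
  then have "h \<in> mod_hom B S (regular B)"
    using reg.submoduleD(1)[OF N] by (auto simp: mod_hom_def)
  then have "h x = h y" if "x \<in> carrier S" "y \<in> carrier S" for x y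
    using simple_hom_vanishes_regular[OF S fd] that unfolding hom_vanishes_def by metis
  then have eq: "x = y" if "x \<in> carrier S" "y \<in> carrier S" for x y
    using inj_onD[OF h(2)] that by blast
  interpret S: left_module B S using S by (simp add: simple_module_def)
  have "carrier S = {\<zero>\<^bsub>S\<^esub>}" using eq S.M.zero_closed by blast
  then show False using S by (simp add: simple_module_def)
qed

text \<open>The image of a nonzero map is a finitely generated submodule of \<open>N\<close>, hence
  finitely presented by coherence, and the map embeds \<open>S\<close> onto it.\<close>

lemma simple_hom_vanishes_coherent:
  assumes S: "simple_module B S" and fd: "finite_dimensional K (underlying_space B S)"
    and N: "coherent B N"
  shows "hom_vanishes B S N"
proof (rule ccontr)
  have M: "left_module B S" and nz: "carrier S \<noteq> {\<zero>\<^bsub>S\<^esub>}" using S by (auto simp: simple_module_def)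
  have NM: "left_module B N" using N by (simp add: coherent_def pseudo_coherent_def)
  interpret S: left_module B S by fact
  interpret N: left_module B N by fact
  assume "\<not> ?thesis"
  then obtain h y where h: "h \<in> mod_hom B S N" "y \<in> carrier S" "h y \<noteq> \<zero>\<^bsub>N\<^esub>"
    by (auto simp: hom_vanishes_def)
  have hD: "\<And>x. x \<in> carrier S \<Longrightarrow> h x \<in> carrier N"
    "\<And>x y. \<lbrakk>x \<in> carrier S; y \<in> carrier S\<rbrakk> \<Longrightarrow> h (x \<oplus>\<^bsub>S\<^esub> y) = h x \<oplus>\<^bsub>N\<^esub> h y"
    "\<And>x a. \<lbrakk>x \<in> carrier S; a \<in> carrier B\<rbrakk> \<Longrightarrow> h (a \<odot>\<^bsub>S\<^esub> x) = a \<odot>\<^bsub>N\<^esub> h x"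
    using h by (auto simp: mod_hom_def)
  let ?H = "h ` carrier S"
  have H: "submodule ?H B N" by (rule S.mod_hom_submodule_image[OF NM h(1) S.carrier_submodule])
  obtain X where X: "finite X" "is_basis K (underlying_space B S) X"
    using fd by (auto simp: finite_dimensional_def)
  then have XS: "X \<subseteq> carrier S" by (auto simp: is_basis_def underlying_space_def restrict_scalars_def)
  then have hX: "h ` X \<subseteq> carrier N" "h ` X \<subseteq> ?H" using hD(1) by auto
  note g = N.submoduleD[OF N.generated_submodule_submodule[OF hX(1)]]
  have "{x \<in> carrier S. h x \<in> generated_submodule B N (h ` X)} = carrier S"
    using XS N.generated_submodule_incl[of "h ` X"] S.mod_hom_zero[OF NM h(1)] hD g
    by (intro subspace_eq_carrier[OF fd X(2)]) (auto intro!: S.smult_closed)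
  then have "generated_submodule B N (h ` X) = ?H"
    using N.generated_submodule_least[OF H hX(2)] by blast
  then have "finitely_generated B (N\<lparr>carrier := ?H\<rparr>)"
    unfolding finitely_generated_def
    using X(1) XS N.generated_submodule_restrict[OF H hX(2)] by (intro exI[of _ "h ` X"]) auto
  then have "finitely_presented B (N\<lparr>carrier := ?H\<rparr>)"
    using N H unfolding coherent_def pseudo_coherent_def by blast
  then obtain n p where p: "p \<in> mod_hom B (free_power B n) (N\<lparr>carrier := ?H\<rparr>)"
    "p ` carrier (free_power B n) = ?H" "finitely_generated B
      ((free_power B n)\<lparr>carrier := {v \<in> carrier (free_power B n). p v = \<zero>\<^bsub>N\<^esub>}\<rparr>)"
    by (auto simp: finitely_presented_def)
  have "p v \<in> carrier N" if "v \<in> carrier (free_power B n)" for v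
    using p(2) that N.submoduleD(1)[OF H] by blast
  then have "p \<in> mod_hom B (free_power B n) N"
    using p(1) by (auto simp: mod_hom_def)
  then show False
    using no_finite_dimensional_finitely_presented[OF M fd NM h(1) simple_module_mod_hom_inj[OF S NM h] _ p(2,3)] nz
    by blast
qed

text \<open>The carrier type of \<open>S\<close> stays generic, so that the result also covers the
  trivial module, whose elements have type \<open>'k\<close>.\<close>

lemma simple_finite_dimensional_vanishing:
  fixes S :: "('a, 's) module"
  assumes "simple_module B S \<and> finite_dimensional K (underlying_space B S)"
  shows "(\<nexists>N. submodule N B (regular B) \<and> mod_iso B S ((regular B)\<lparr>carrier := N\<rparr>)) \<and>
    hom_vanishes B S (regular B) \<and>
    (\<forall>N :: ('a, 'n) module. coherent B N \<longrightarrow> hom_vanishes B S N)"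
proof (intro conjI)
  show "\<nexists>N. submodule N B (regular B) \<and> mod_iso B S ((regular B)\<lparr>carrier := N\<rparr>)"
    using simple_not_iso_submodule assms by metis
  show "hom_vanishes B S (regular B)" using simple_hom_vanishes_regular assms by metis
  show "\<forall>N :: ('a, 'n) module. coherent B N \<longrightarrow> hom_vanishes B S N"
    using simple_hom_vanishes_coherent assms by metis
qed

end

text \<open>The scalar \<open>c 1\<close> acts on \<open>K\<close> as multiplication by
  \<open>c\<close>. Hence submodules are ideals of a field, and the underlying space is
  \<open>K\<close> with basis \<open>1\<close>.\<close>

lemma (in k_algebra) augmentation_module:
  assumes \<eta>: "\<eta> \<in> algebra_hom K A (regular K)"
  shows "simple_module A (restrict_scalars \<eta> (regular K))"
    and "finite_dimensional K (underlying_space A (restrict_scalars \<eta> (regular K)))"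
proof -
  let ?T = "restrict_scalars \<eta> (regular K)" and ?V = "underlying_space A (restrict_scalars \<eta> (regular K))"
  have hom: "\<And>x. x \<in> carrier A \<Longrightarrow> \<eta> x \<in> carrier K"
    "\<And>x y. \<lbrakk>x \<in> carrier A; y \<in> carrier A\<rbrakk> \<Longrightarrow> \<eta> (x \<oplus>\<^bsub>A\<^esub> y) = \<eta> x \<oplus>\<^bsub>K\<^esub> \<eta> y"
    "\<And>x y. \<lbrakk>x \<in> carrier A; y \<in> carrier A\<rbrakk> \<Longrightarrow> \<eta> (x \<otimes>\<^bsub>A\<^esub> y) = \<eta> x \<otimes>\<^bsub>K\<^esub> \<eta> y"
    "\<And>c x. \<lbrakk>c \<in> carrier K; x \<in> carrier A\<rbrakk> \<Longrightarrow> \<eta> (c \<odot>\<^bsub>A\<^esub> x) = c \<otimes>\<^bsub>K\<^esub> \<eta> x"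
    "\<eta> \<one>\<^bsub>A\<^esub> = \<one>\<^bsub>K\<^esub>"
    using \<eta> by (auto simp: algebra_hom_def ring_hom_def mod_hom_def regular_def)
  have \<eta>c: "\<eta> (c \<odot>\<^bsub>A\<^esub> \<one>\<^bsub>A\<^esub>) = c" if "c \<in> carrier K" for c
    using hom(4)[OF that A.one_closed] hom(5) that by simp
  have ab: "abelian_group ?T" "abelian_group ?V"
    by (rule abelian_groupI; auto simp: underlying_space_def restrict_scalars_def regular_def R.a_ac
        intro: R.l_neg R.a_inv_closed)+
  have T: "left_module A ?T"
    using ab(1) A.ring_axioms hom
    by (intro left_module.intro left_module_axioms.intro)
      (auto simp: restrict_scalars_def regular_def R.l_distr R.r_distr R.m_assoc)
  show "simple_module A ?T"
    unfolding simple_module_def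
  proof (intro conjI allI impI)
    show "left_module A ?T" by (rule T)
    have "carrier K \<noteq> {\<zero>\<^bsub>K\<^esub>}" using R.one_closed K.one_not_zero by blast
    then show "carrier ?T \<noteq> {\<zero>\<^bsub>?T\<^esub>}" by (simp add: restrict_scalars_def regular_def)
    fix N assume "submodule N A ?T"
    note N = left_module.submoduleD[OF T this]
    have zero: "\<zero>\<^bsub>K\<^esub> \<in> N" "N \<subseteq> carrier K" using N by (auto simp: restrict_scalars_def regular_def)
    have "carrier K \<subseteq> N" if z: "z \<in> N" "z \<noteq> \<zero>\<^bsub>K\<^esub>" for z
    proof
      fix c assume c: "c \<in> carrier K"
      have u: "z \<in> Units K" using z zero K.field_Units by auto
      \<comment> \<open>This element acts as \<open>c\<close> divided by \<open>z\<close> and moves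
        \<open>z\<close> to \<open>c\<close>.\<close>
      let ?a = "(c \<otimes>\<^bsub>K\<^esub> inv\<^bsub>K\<^esub> z) \<odot>\<^bsub>A\<^esub> \<one>\<^bsub>A\<^esub>"
      have "?a \<in> carrier A" using c u by simp
      then have "\<eta> ?a \<otimes>\<^bsub>K\<^esub> z \<in> N" using N(4)[of ?a z] z by (simp add: restrict_scalars_def regular_def)
      moreover have "\<eta> ?a \<otimes>\<^bsub>K\<^esub> z = c" using c u subsetD[OF zero(2) z(1)] by (simp add: \<eta>c R.m_assoc)
      ultimately show "c \<in> N" by simp
    qed
    then show "N = {\<zero>\<^bsub>?T\<^esub>} \<or> N = carrier ?T"
      using zero by (auto simp: restrict_scalars_def regular_def)
  qed
  have V: "module K ?V"
    using ab(2) R.cring_axioms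
    by (intro moduleI) (auto simp: underlying_space_def restrict_scalars_def regular_def \<eta>c hom(5)
        R.l_distr R.r_distr R.m_assoc)
  interpret V: left_module K ?V by (rule left_module_of_module[OF V])
  have "is_basis K ?V {\<one>\<^bsub>K\<^esub>}"
    unfolding is_basis_def
  proof (intro conjI allI impI)
    show one: "{\<one>\<^bsub>K\<^esub>} \<subseteq> carrier ?V" by (simp add: underlying_space_def restrict_scalars_def regular_def)
    have "c \<in> generated_submodule K ?V {\<one>\<^bsub>K\<^esub>}" if "c \<in> carrier K" for c
      using V.submoduleD(4)[OF V.generated_submodule_submodule[OF one] that, of "\<one>\<^bsub>K\<^esub>"]
        V.generated_submodule_incl[of "{\<one>\<^bsub>K\<^esub>}"] that
      by (simp add: underlying_space_def restrict_scalars_def regular_def \<eta>c)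
    then show "generated_submodule K ?V {\<one>\<^bsub>K\<^esub>} = carrier ?V"
      using V.generated_submodule_carrier[OF one]
      by (auto simp: underlying_space_def restrict_scalars_def regular_def)
    fix Y c assume Y: "finite Y \<and> Y \<subseteq> {\<one>\<^bsub>K\<^esub>} \<and> c \<in> Y \<rightarrow> carrier K \<and>
      finsum ?V (\<lambda>y. c y \<odot>\<^bsub>?V\<^esub> y) Y = \<zero>\<^bsub>?V\<^esub>"
    show "\<forall>y\<in>Y. c y = \<zero>\<^bsub>K\<^esub>"
    proof (cases "Y = {}")
      case False
      then have Y1: "Y = {\<one>\<^bsub>K\<^esub>}" and c: "c \<one>\<^bsub>K\<^esub> \<in> carrier K" using Y by auto
      have sm: "c \<one>\<^bsub>K\<^esub> \<odot>\<^bsub>?V\<^esub> \<one>\<^bsub>K\<^esub> = c \<one>\<^bsub>K\<^esub>" "c \<one>\<^bsub>K\<^esub> \<in> carrier ?V" "\<zero>\<^bsub>?V\<^esub> = \<zero>\<^bsub>K\<^esub>"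
        using c by (simp_all add: underlying_space_def restrict_scalars_def regular_def \<eta>c)
      have "finsum ?V (\<lambda>y. c y \<odot>\<^bsub>?V\<^esub> y) {\<one>\<^bsub>K\<^esub>} = c \<one>\<^bsub>K\<^esub>"
        using sm V.M.r_zero[OF sm(2)] by (simp add: V.M.finsum_insert)
      then show ?thesis using Y Y1 sm by simp
    qed simp
  qed
  then show "finite_dimensional K ?V" using V by (auto simp: finite_dimensional_def)
qed

section \<open>Opposite algebras and the augmentation\<close>

lemma opposite_opposite: "opposite (opposite R) = R"
  by (simp add: opposite_def)

lemma opposite_carrier_update: "(opposite R)\<lparr>carrier := H\<rparr> = opposite (R\<lparr>carrier := H\<rparr>)"
  by (simp add: opposite_def)

lemma submodule_opposite: "submodule H K (opposite V) = submodule H K V"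
  by (simp add: submodule_def submodule_axioms_def opposite_def)

lemma module_opposite: "module K (opposite V) = module K V"
  by (simp add: module_def module_axioms_def abelian_group_def abelian_monoid_def
      abelian_group_axioms_def opposite_def)

text \<open>Passing to the opposite alters only the ring multiplication, which is invisible to the
  vector space structure.\<close>

lemma finite_dimensional_opposite:
  fixes V :: "('k, 'v, 'q) module_scheme"
  shows "finite_dimensional K (opposite V) = finite_dimensional K V"
proof -
  have "generated_submodule K (opposite V) = generated_submodule K V"
    by (simp add: generated_submodule_def submodule_opposite fun_eq_iff)
  moreover have "finsum (opposite V) f Y = finsum V f Y" for f :: "'v \<Rightarrow> 'v" and Y
    by (simp add: finsum_def opposite_def)
  moreover have "carrier (opposite V) = carrier V" "\<zero>\<^bsub>opposite V\<^esub> = \<zero>\<^bsub>V\<^esub>" "smult (opposite V) = smult V"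
    by (simp_all add: opposite_def)
  ultimately show ?thesis
    by (simp add: finite_dimensional_def is_basis_def module_opposite)
qed

lemma subring_opposite: "subring H (opposite R) = subring H R"
  by (auto simp: subring_def submonoid_def opposite_def)

lemma ring_opposite: "ring R \<Longrightarrow> ring (opposite R)"
proof -
  assume "ring R"
  then interpret ring R .
  show ?thesis
    by (rule ringI; (rule abelian_groupI monoidI)?)
      (auto simp: opposite_def a_ac m_assoc l_distr r_distr intro: l_neg a_inv_closed)
qed

lemma (in k_algebra) k_algebra_opposite: "k_algebra K (opposite A)"
proof -
  have "module K (opposite A)" using module_axioms by (simp add: module_opposite)
  moreover have "ring (opposite A)" by (rule ring_opposite[OF A.ring_axioms])
  ultimately show ?thesis
    using K.field_axioms
    by (intro k_algebra.intro k_algebra_axioms.intro)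
      (auto simp: opposite_def smult_mult_left smult_mult_right)
qed

context locally_frobenius
begin

lemma free_tower: "free_tower K A \<Lambda> r l0 F"
proof (intro free_tower.intro free_tower_axioms.intro)
  show "finite_dimensional K (A\<lparr>carrier := F l\<rparr>)" if "l \<in> \<Lambda>" for l
    using symmetric_frobenius[OF that] by (simp add: symmetric_frobenius_algebra_def)
qed (use frobenius_shape_axioms k_algebra_axioms subalgebra proper_inclusion union free_frobenius
    in \<open>auto simp: free_frobenius_extension_def\<close>)

text \<open>Opposites taken twice cancel, so right freeness of the opposite tower is left freeness
  of the original extensions.\<close>

lemma free_tower_opposite: "free_tower K (opposite A) \<Lambda> r l0 F"
proof (intro free_tower.intro free_tower_axioms.intro)
  show "finite_dimensional K ((opposite A)\<lparr>carrier := F l\<rparr>)" if "l \<in> \<Lambda>" for l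
    using symmetric_frobenius[OF that]
    by (simp add: symmetric_frobenius_algebra_def opposite_carrier_update finite_dimensional_opposite)
  show "k_subalgebra K (opposite A) (F l)" if "l \<in> \<Lambda>" for l
    using subalgebra[OF that] by (simp add: k_subalgebra_def subring_opposite submodule_opposite)
  show "carrier (opposite A) = (\<Union>l\<in>\<Lambda>. F l)" using union by (simp add: opposite_def)
  show "free_module (opposite (opposite A\<lparr>carrier := F l\<rparr>))
      (restrict_scalars id (regular (opposite (opposite A\<lparr>carrier := F m\<rparr>))))"
    if "(l, m) \<in> r" "l \<noteq> m" for l m
    using free_frobenius[OF that]
    by (simp add: free_frobenius_extension_def opposite_carrier_update opposite_opposite)
qed (use frobenius_shape_axioms k_algebra_opposite proper_inclusion in auto)

text \<open>Two levels containing \<open>x\<close> have a common upper bound, where both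
  augmentations agree on \<open>x\<close>.\<close>

lemma union_augmentation_eq:
  assumes "l \<in> \<Lambda>" "x \<in> F l"
  shows "union_augmentation \<Lambda> F \<epsilon> x = \<epsilon> l x"
  unfolding union_augmentation_def
proof (rule the_equality)
  show "\<exists>k\<in>\<Lambda>. x \<in> F k \<and> \<epsilon> l x = \<epsilon> k x" using assms by auto
next
  fix c assume "\<exists>k\<in>\<Lambda>. x \<in> F k \<and> c = \<epsilon> k x"
  then obtain k where k: "k \<in> \<Lambda>" "x \<in> F k" "c = \<epsilon> k x" by auto
  obtain u where "(l, u) \<in> r" "(k, u) \<in> r" using directed[OF assms(1) k(1)] by auto
  then show "c = \<epsilon> l x" using augmentation_compatible assms k by metis
qed

lemma union_augmentation_algebra_hom: "union_augmentation \<Lambda> F \<epsilon> \<in> algebra_hom K A (regular K)"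
proof -
  interpret tower: free_tower K A \<Lambda> r l0 F by (rule free_tower)
  let ?\<eta> = "union_augmentation \<Lambda> F \<epsilon>"
  have aug: "\<epsilon> l x \<in> carrier K" "\<epsilon> l (x \<oplus>\<^bsub>A\<^esub> y) = \<epsilon> l x \<oplus>\<^bsub>K\<^esub> \<epsilon> l y" "\<epsilon> l (x \<otimes>\<^bsub>A\<^esub> y) = \<epsilon> l x \<otimes>\<^bsub>K\<^esub> \<epsilon> l y"
    "\<epsilon> l \<one>\<^bsub>A\<^esub> = \<one>\<^bsub>K\<^esub>" if "l \<in> \<Lambda>" "x \<in> F l" "y \<in> F l" for l x y
    using augmentation[OF that(1)] that(2,3)
    by (auto simp: algebra_hom_def ring_hom_def mod_hom_def regular_def)
  have aug_smult: "\<epsilon> l (c \<odot>\<^bsub>A\<^esub> x) = c \<otimes>\<^bsub>K\<^esub> \<epsilon> l x" if "l \<in> \<Lambda>" "x \<in> F l" "c \<in> carrier K" for l x c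
    using augmentation[OF that(1)] that(2,3) by (auto simp: algebra_hom_def mod_hom_def regular_def)
  \<comment> \<open>Every identity for the union involves at most two elements and can be checked at
    one level containing them.\<close>
  have common: "\<exists>l\<in>\<Lambda>. x \<in> F l \<and> y \<in> F l" if "x \<in> carrier A" "y \<in> carrier A" for x y
    using tower.finite_subset_level[of "{x, y}"] that by auto
  have closed: "?\<eta> x \<in> carrier K" if "x \<in> carrier A" for x
    using common[OF that that] union_augmentation_eq aug(1) by metis
  have add: "?\<eta> (x \<oplus>\<^bsub>A\<^esub> y) = ?\<eta> x \<oplus>\<^bsub>K\<^esub> ?\<eta> y" and mult: "?\<eta> (x \<otimes>\<^bsub>A\<^esub> y) = ?\<eta> x \<otimes>\<^bsub>K\<^esub> ?\<eta> y"
    if xy: "x \<in> carrier A" "y \<in> carrier A" for x y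
  proof -
    obtain l where l: "l \<in> \<Lambda>" "x \<in> F l" "y \<in> F l" using common[OF xy] by auto
    then have "x \<oplus>\<^bsub>A\<^esub> y \<in> F l" "x \<otimes>\<^bsub>A\<^esub> y \<in> F l" using tower.F_closed(4,5) by auto
    then show "?\<eta> (x \<oplus>\<^bsub>A\<^esub> y) = ?\<eta> x \<oplus>\<^bsub>K\<^esub> ?\<eta> y" "?\<eta> (x \<otimes>\<^bsub>A\<^esub> y) = ?\<eta> x \<otimes>\<^bsub>K\<^esub> ?\<eta> y"
      using l aug[OF l] by (simp_all add: union_augmentation_eq[OF l(1)])
  qed
  have smult: "?\<eta> (c \<odot>\<^bsub>A\<^esub> x) = c \<otimes>\<^bsub>K\<^esub> ?\<eta> x" if c: "c \<in> carrier K" and x: "x \<in> carrier A" for c x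
  proof -
    obtain l where l: "l \<in> \<Lambda>" "x \<in> F l" using common[OF x x] by auto
    then have "c \<odot>\<^bsub>A\<^esub> x \<in> F l"
      using subalgebra c by (auto simp: k_subalgebra_def dest: submodule.smult_closed)
    then show ?thesis using l aug_smult[OF l c] by (simp add: union_augmentation_eq[OF l(1)])
  qed
  have "?\<eta> \<one>\<^bsub>A\<^esub> = \<one>\<^bsub>K\<^esub>"
    using aug(4)[OF initial_in] tower.F_closed(3)[OF initial_in] union_augmentation_eq[OF initial_in] by metis
  then show ?thesis
    using closed add mult smult by (auto simp: algebra_hom_def ring_hom_def mod_hom_def regular_def)
qed

end

text \<open>The target is commutative, so the order of factors does not affect
  multiplicativity.\<close>

lemma algebra_hom_opposite:
  assumes "cring K" "\<eta> \<in> algebra_hom K A (regular K)"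
  shows "\<eta> \<in> algebra_hom K (opposite A) (regular K)"
proof -
  interpret cring K by fact
  show ?thesis
    using assms(2)
    by (auto simp: algebra_hom_def ring_hom_def mod_hom_def regular_def opposite_def Pi_iff m_comm)
qed

(* B = A is the statement for left A-modules, B = opposite A the one for right A-modules. *)

theorem corollary4p26:
  fixes K :: "'k ring" and A B :: "('k, 'a) module"
    and \<Lambda> :: "'l set" and r :: "('l \<times> 'l) set" and l0 :: 'l
    and F :: "'l \<Rightarrow> 'a set" and \<epsilon> :: "'l \<Rightarrow> 'a \<Rightarrow> 'k"
  assumes "locally_frobenius K A \<Lambda> r l0 F \<epsilon>"
    and "B = A \<or> B = opposite A"
  shows
    "(\<forall>S :: ('a, 's) module.
        simple_module B S \<and> finite_dimensional K (underlying_space B S) \<longrightarrow>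
          (\<nexists>N. submodule N B (regular B) \<and> mod_iso B S ((regular B)\<lparr>carrier := N\<rparr>)) \<and>
          hom_vanishes B S (regular B) \<and>
          (\<forall>N :: ('a, 'n) module. coherent B N \<longrightarrow> hom_vanishes B S N)) \<and>
     (let k = trivial_module K \<Lambda> F \<epsilon> in
        simple_module B k \<and> finite_dimensional K (underlying_space B k) \<and>
        (\<nexists>N. submodule N B (regular B) \<and> mod_iso B k ((regular B)\<lparr>carrier := N\<rparr>)) \<and>
        hom_vanishes B k (regular B) \<and>
        (\<forall>N :: ('a, 'n) module. coherent B N \<longrightarrow> hom_vanishes B k N))"
proof -
  interpret locally_frobenius K A \<Lambda> r l0 F \<epsilon> by fact
  interpret tower: free_tower K B \<Lambda> r l0 F
    using assms(2) free_tower free_tower_opposite by auto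
  let ?k = "trivial_module K \<Lambda> F \<epsilon>"
  have "union_augmentation \<Lambda> F \<epsilon> \<in> algebra_hom K B (regular K)"
    using assms(2) union_augmentation_algebra_hom algebra_hom_opposite[OF R.cring_axioms] by auto
  then have k: "simple_module B ?k \<and> finite_dimensional K (underlying_space B ?k)"
    using tower.augmentation_module by (simp add: trivial_module_def)
  show ?thesis
    unfolding Let_def
    by (rule conjI[OF allI[OF impI[OF tower.simple_finite_dimensional_vanishing]]
        conjI[OF conjunct1[OF k] conjI[OF conjunct2[OF k] tower.simple_finite_dimensional_vanishing[OF k]]]])
qed

end
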